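(* For integers $a\ge b\ge0$, the restriction of $V(a,b)$ to the subalgebra $\mathfrak s\cong\mathfrak{sl}_2(\mathbb C)\times\mathfrak{sl}_2(\mathbb C)$ spanned by $\hat e_1,\hat f_1,\hat h_1,\hat e_2,\hat f_2,\hat h_2$ decomposes as \[V(a,b)\big|_{\mathfrak s}\cong\bigoplus_{(p,q)\in\Phi(a,b)}L(p)\boxtimes L(q),\qquad \Phi(a,b)=\{(a-r-s,\ b-r+s):0\le r\le b,\ 0\le s\le a-b\},\] where $L(p)$ is the irreducible $\mathfrak{sl}_2$-module of dimension $p+1$ (the first factor acted on by $\hat e_1,\hat f_1,\hat h_1$, the second by $\hat e_2,\hat f_2,\hat h_2$). In particular each $L(p)\boxtimes L(q)$, $(p,q)\in\Phi(a,b)$, occurs with multiplicity one, and the trivial module $L(0)\boxtimes L(0)$ occurs if and only if $a=b$.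
   Context: Let $\Omega=\begin{pmatrix}0&I_2\\-I_2&0\end{pmatrix}$, $\mathfrak{sp}_4(\mathbb C)=\{X\in M_4(\mathbb C): X^T\Omega+\Omega X=0\}$, and $E_{ij}$ the $4\times4$ elementary matrices. Set $\hat e_1=E_{13}$, $\hat f_1=E_{31}$, $\hat h_1=E_{11}-E_{33}$, $\hat e_2=E_{24}$, $\hat f_2=E_{42}$, $\hat h_2=E_{22}-E_{44}$; $\hat h_1,\hat h_2$ span a Cartan subalgebra, with dual basis $\epsilon_1,\epsilon_2$. Simple roots are $\epsilon_1-\epsilon_2$ and $2\epsilon_2$. For integers $a\ge b\ge0$, $V(a,b)$ denotes the irreducible finite-dimensional $\mathfrak{sp}_4(\mathbb C)$-module (equivalently $\operatorname{Sp}(4,\mathbb C)$-module) of highest weight $a\epsilon_1+b\epsilon_2$. *)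

theory Defs
  imports "HOL-Analysis.Analysis"
begin

text \<open>4x4 complex matrices are modelled as complex^4^4; the paper's matrix index k in 1..4
  corresponds to the element of type 4 given by idx4 k.\<close>

definition idx4 :: "nat \<Rightarrow> 4" where
  "idx4 k = of_nat (k - 1)"

definition Emat :: "nat \<Rightarrow> nat \<Rightarrow> complex^4^4" where
  "Emat i j = (\<chi> k l. if k = idx4 i \<and> l = idx4 j then 1 else 0)"

definition smul :: "complex \<Rightarrow> complex^'m^'k \<Rightarrow> complex^'m^'k" where
  "smul c X = (\<chi> i j. c * X$i$j)"

definition Omega :: "complex^4^4" where
  "Omega = Emat 1 3 + Emat 2 4 - Emat 3 1 - Emat 4 2"

definition sp4 :: "(complex^4^4) set" where
  "sp4 = {X. transpose X ** Omega + Omega ** X = 0}"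

definition e1 :: "complex^4^4" where "e1 = Emat 1 3"
definition f1 :: "complex^4^4" where "f1 = Emat 3 1"
definition h1 :: "complex^4^4" where "h1 = Emat 1 1 - Emat 3 3"
definition e2 :: "complex^4^4" where "e2 = Emat 2 4"
definition f2 :: "complex^4^4" where "f2 = Emat 4 2"
definition h2 :: "complex^4^4" where "h2 = Emat 2 2 - Emat 4 4"

text \<open>Root vectors for the positive roots eps1-eps2, 2eps2, eps1+eps2, 2eps1.\<close>
definition pos_root_vectors :: "(complex^4^4) set" where
  "pos_root_vectors = {Emat 1 2 - Emat 4 3, Emat 2 4, Emat 1 4 + Emat 2 3, Emat 1 3}"

text \<open>The subalgebra s spanned by e1,f1,h1,e2,f2,h2.\<close>
definition s_alg :: "(complex^4^4) set" where
  "s_alg = {X. \<exists>c1 c2 c3 c4 c5 c6. X = smul c1 e1 + smul c2 f1 + smul c3 h1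
                                     + smul c4 e2 + smul c5 f2 + smul c6 h2}"

text \<open>A finite-dimensional representation of sp4 on complex^'n (Lie algebra homomorphism
  sp4 -> gl_n(C)).\<close>
definition is_sp4_rep :: "(complex^4^4 \<Rightarrow> complex^'n^'n) \<Rightarrow> bool" where
  "is_sp4_rep \<rho> \<longleftrightarrow>
     (\<forall>X\<in>sp4. \<forall>Y\<in>sp4. \<rho> (X + Y) = \<rho> X + \<rho> Y) \<and>
     (\<forall>c. \<forall>X\<in>sp4. \<rho> (smul c X) = smul c (\<rho> X)) \<and>
     (\<forall>X\<in>sp4. \<forall>Y\<in>sp4. \<rho> (X ** Y - Y ** X) = \<rho> X ** \<rho> Y - \<rho> Y ** \<rho> X)"

definition invariant_under :: "(complex^4^4 \<Rightarrow> complex^'n^'n) \<Rightarrow> (complex^4^4) set \<Rightarrow> (complex^'n) set \<Rightarrow> bool" where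
  "invariant_under \<rho> S W \<longleftrightarrow> (\<forall>X\<in>S. \<forall>w\<in>W. \<rho> X *v w \<in> W)"

definition sp4_irreducible :: "(complex^4^4 \<Rightarrow> complex^'n^'n) \<Rightarrow> bool" where
  "sp4_irreducible \<rho> \<longleftrightarrow>
     (\<forall>W. vec.subspace W \<and> invariant_under \<rho> sp4 W \<longrightarrow> W = {0} \<or> W = UNIV)"

text \<open>Existence of a highest weight vector of weight a eps1 + b eps2.\<close>
definition has_highest_weight :: "(complex^4^4 \<Rightarrow> complex^'n^'n) \<Rightarrow> nat \<Rightarrow> nat \<Rightarrow> bool" where
  "has_highest_weight \<rho> a b \<longleftrightarrow>
     (\<exists>v. v \<noteq> 0 \<and> \<rho> h1 *v v = of_nat a *s v \<and> \<rho> h2 *v v = of_nat b *s v \<and>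
          (\<forall>X\<in>pos_root_vectors. \<rho> X *v v = 0))"

text \<open>W is an s-submodule isomorphic to L(p) (x) L(q): it has a basis w(i,j), i<=p, j<=q,
  on which s acts by the standard formulas of the irreducible sl2-modules L(p), L(q)
  (first factor via e1,f1,h1, second via e2,f2,h2).\<close>
definition is_LpLq :: "(complex^4^4 \<Rightarrow> complex^'n^'n) \<Rightarrow> (complex^'n) set \<Rightarrow> nat \<Rightarrow> nat \<Rightarrow> bool" where
  "is_LpLq \<rho> W p q \<longleftrightarrow>
     (\<exists>w :: nat \<times> nat \<Rightarrow> complex^'n.
        inj_on w ({..p} \<times> {..q}) \<and> vec.independent (w ` ({..p} \<times> {..q})) \<and>
        vec.span (w ` ({..p} \<times> {..q})) = W \<and>
        (\<forall>i\<le>p. \<forall>j\<le>q.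
           \<rho> h1 *v w (i,j) = (of_int (int p - 2 * int i)) *s w (i,j) \<and>
           \<rho> f1 *v w (i,j) = (if i < p then w (i+1, j) else 0) \<and>
           \<rho> e1 *v w (i,j) = (if i = 0 then 0 else of_nat (i * (p - i + 1)) *s w (i - 1, j)) \<and>
           \<rho> h2 *v w (i,j) = (of_int (int q - 2 * int j)) *s w (i,j) \<and>
           \<rho> f2 *v w (i,j) = (if j < q then w (i, j+1) else 0) \<and>
           \<rho> e2 *v w (i,j) = (if j = 0 then 0 else of_nat (j * (q - j + 1)) *s w (i, j - 1))))"

definition Idx :: "nat \<Rightarrow> nat \<Rightarrow> (nat \<times> nat) set" where
  "Idx a b = {(r, s). r \<le> b \<and> s \<le> a - b}"

definition phi :: "nat \<Rightarrow> nat \<Rightarrow> nat \<times> nat \<Rightarrow> nat \<times> nat" where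
  "phi a b = (\<lambda>(r, s). (a - r - s, b - r + s))"

definition Phi :: "nat \<Rightarrow> nat \<Rightarrow> (nat \<times> nat) set" where
  "Phi a b = phi a b ` Idx a b"

end

theory Submission
  imports Defs
begin

text \<open>
  Let \<open>v\<close> be a highest weight vector. Applying to \<open>v\<close> first \<open>s\<close> times a corrected version of
  the root vector \<open>f_minus\<close> and then \<open>r\<close> times a corrected \<open>f_plus\<close> gives vectors \<open>u(r, s)\<close>
  killed by \<open>e1\<close>, \<open>e2\<close>, of weight \<open>(a - r - s, b - r + s)\<close>. Since the Casimir operator is a scalar
  (Schur), the action of the short root vectors on the \<open>u(r, s)\<close> can be computed explicitly; it
  shows that \<open>u(r, s) \<noteq> 0\<close> exactly for \<open>r \<le> b\<close>, \<open>s \<le> a - b\<close>. By \<open>sl2\<close>-theory each such vector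
  generates a copy of \<open>L(a - r - s) \<otimes> L(b - r + s)\<close> with basis \<open>f1\<^sup>i f2\<^sup>j u(r, s)\<close>. The span of all
  these basis vectors is stable under all of \<open>sp4\<close>, hence is everything by irreducibility, and they
  are linearly independent because \<open>h1\<close>, \<open>h2\<close> and the two \<open>sl2\<close>-Casimir operators separate them.
\<close>

section \<open>Linear independence of eigenvectors\<close>

lemma matrix_vector_mult_span_closed:
  fixes M :: "'a::field^'n^'n"
  assumes "\<And>x. x \<in> B \<Longrightarrow> M *v x \<in> vec.span B" and "y \<in> vec.span B"
  shows "M *v y \<in> vec.span B"
proof -
  have "vec.subspace {y. M *v y \<in> vec.span B}"
    by (simp add: vec.subspace_def vec.add vec.scale vec.span_add vec.span_scale vec.span_zero)
  with assms(1) have "vec.span B \<subseteq> {y. M *v y \<in> vec.span B}"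
    by (intro vec.span_minimal) auto
  with assms(2) show ?thesis by auto
qed

lemma vec_subspace_scale_cancel:
  fixes x :: "'a::field^'n"
  assumes "vec.subspace W" "c *s x \<in> W" "c \<noteq> 0"
  shows "x \<in> W"
  using vec.subspace_scale[OF assms(1,2), of "inverse c"] assms(3) by (simp add: vector_smult_assoc)

definition independent_family :: "'i set \<Rightarrow> ('i \<Rightarrow> 'a::field^'n) \<Rightarrow> bool" where
  "independent_family I x \<longleftrightarrow> (\<forall>c. (\<Sum>i\<in>I. c i *s x i) = 0 \<longrightarrow> (\<forall>i\<in>I. c i = 0))"

lemma independent_familyD:
  "independent_family I x \<Longrightarrow> (\<Sum>i\<in>I. c i *s x i) = 0 \<Longrightarrow> i \<in> I \<Longrightarrow> c i = 0"
  by (auto simp: independent_family_def)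

lemma independent_family_inj_on:
  fixes x :: "'i \<Rightarrow> 'a::field^'n"
  assumes "finite I" "independent_family I x"
  shows "inj_on x I"
proof (rule inj_onI, rule ccontr)
  fix i j assume ij: "i \<in> I" "j \<in> I" "x i = x j" "i \<noteq> j"
  define c where "c k = (if k = i then 1 else if k = j then -1 else (0::'a))" for k
  have "(\<Sum>k\<in>I. c k *s x k) = (\<Sum>k\<in>{i,j}. c k *s x k)"
    by (rule sum.mono_neutral_right) (use assms(1) ij in \<open>auto simp: c_def\<close>)
  also have "\<dots> = 0"
    using ij(3,4) by (simp add: c_def)
  finally have "c i = 0"
    by (rule independent_familyD[OF assms(2) _ ij(1)])
  then show False by (simp add: c_def)
qed

lemma independent_family_independent:
  assumes "finite I" "independent_family I x"
  shows "vec.independent (x ` I)"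
proof (rule vec.independent_if_scalars_zero)
  show "finite (x ` I)" using assms(1) by simp
  fix f y assume sum: "(\<Sum>y\<in>x ` I. f y *s y) = 0" and y: "y \<in> x ` I"
  have "(\<Sum>i\<in>I. f (x i) *s x i) = 0"
    using sum by (simp add: sum.reindex[OF independent_family_inj_on[OF assms]])
  with y show "f y = 0"
    using independent_familyD[OF assms(2), of "\<lambda>i. f (x i)"] by auto
qed

lemma independent_family_subsingleton:
  assumes "\<And>i j. i \<in> I \<Longrightarrow> j \<in> I \<Longrightarrow> i = j" "\<And>i. i \<in> I \<Longrightarrow> x i \<noteq> 0"
  shows "independent_family I x"
  unfolding independent_family_def
proof (intro allI impI ballI)
  fix c i assume sum: "(\<Sum>i\<in>I. c i *s x i) = 0" and i: "i \<in> I"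
  from assms(1) i have "I = {i}" by auto
  with sum have "c i *s x i = 0" by simp
  with assms(2) i show "c i = 0" by (simp add: vec.scale_eq_0_iff)
qed

lemma eigenvectors_sum_eq_0:
  fixes T :: "'a::field^'n^'n"
  assumes "finite L" "\<And>l. l \<in> L \<Longrightarrow> T *v y l = l *s y l" "(\<Sum>l\<in>L. y l) = 0"
  shows "\<forall>l\<in>L. y l = 0"
  using assms
proof (induction L arbitrary: y rule: finite_induct)
  case empty then show ?case by simp
next
  case (insert l0 L)
  from insert.prems(2) have rest: "(\<Sum>l\<in>L. y l) = - y l0"
    using insert.hyps by (simp add: eq_neg_iff_add_eq_0 add.commute)
  \<comment> \<open>Applying T - l0 kills y l0 and leaves a shorter vanishing sum of eigenvectors.\<close>
  have "(\<Sum>l\<in>L. l *s y l) = T *v (\<Sum>l\<in>L. y l)"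
    using insert.prems(1) by (simp add: vec.sum)
  also have "\<dots> = l0 *s (\<Sum>l\<in>L. y l)"
    using insert.prems(1) by (simp add: rest vec.neg vector_smult_rneg)
  finally have "(\<Sum>l\<in>L. (l - l0) *s y l) = 0"
    by (simp add: vector_sub_rdistrib sum_subtractf vec.scale_sum_right[symmetric])
  moreover have "T *v ((l - l0) *s y l) = l *s ((l - l0) *s y l)" if "l \<in> L" for l
    using insert.prems(1) that by (simp add: vec.scale vec_eq_iff algebra_simps)
  ultimately have "\<forall>l\<in>L. (l - l0) *s y l = 0"
    using insert.IH[of "\<lambda>l. (l - l0) *s y l"] by simp
  with insert.hyps(2) have "\<forall>l\<in>L. y l = 0"
    by (auto simp: vec.scale_eq_0_iff)
  with rest show ?case by simp
qed

lemma independent_family_eigenspaces: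
  fixes T :: "'a::field^'n^'n"
  assumes fin: "finite I" and eig: "\<And>i. i \<in> I \<Longrightarrow> T *v x i = \<mu> i *s x i"
    and classes: "\<And>l. independent_family {i\<in>I. \<mu> i = l} x"
  shows "independent_family I x"
  unfolding independent_family_def
proof (intro allI impI ballI)
  fix c i assume sum: "(\<Sum>i\<in>I. c i *s x i) = 0" and i: "i \<in> I"
  define y where "y l = (\<Sum>k\<in>{k\<in>I. \<mu> k = l}. c k *s x k)" for l
  have "(\<Sum>l\<in>\<mu> ` I. y l) = (\<Sum>k\<in>I. c k *s x k)"
    unfolding y_def by (rule sum.group) (use fin in auto)
  with sum have "(\<Sum>l\<in>\<mu> ` I. y l) = 0" by simp
  moreover have "T *v y l = l *s y l" for l
  proof -
    have "T *v y l = (\<Sum>k\<in>{k\<in>I. \<mu> k = l}. c k *s (T *v x k))"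
      by (simp add: y_def vec.sum vec.scale)
    also have "\<dots> = (\<Sum>k\<in>{k\<in>I. \<mu> k = l}. l *s (c k *s x k))"
      by (rule sum.cong) (use eig in \<open>auto simp: vector_smult_assoc mult.commute\<close>)
    also have "\<dots> = l *s y l"
      by (simp only: y_def vec.scale_sum_right)
    finally show ?thesis .
  qed
  ultimately have "\<forall>l\<in>\<mu> ` I. y l = 0"
    by (intro eigenvectors_sum_eq_0) (use fin in auto)
  then have "y (\<mu> i) = 0"
    using i by blast
  then show "c i = 0"
    using classes[of "\<mu> i"] i unfolding y_def independent_family_def by auto
qed

lemma independent_family_joint_eigenvectors:
  fixes Ts :: "(('a::field^'n^'n) \<times> ('i \<Rightarrow> 'a)) list"
  assumes "finite I" "\<And>T \<mu> i. (T, \<mu>) \<in> set Ts \<Longrightarrow> i \<in> I \<Longrightarrow> T *v x i = \<mu> i *s x i"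
    and "inj_on (\<lambda>i. map (\<lambda>(T, \<mu>). \<mu> i) Ts) I" "\<And>i. i \<in> I \<Longrightarrow> x i \<noteq> 0"
  shows "independent_family I x"
  using assms
proof (induction Ts arbitrary: I)
  case Nil
  then show ?case by (intro independent_family_subsingleton) (auto dest: inj_onD)
next
  case (Cons T\<mu> Ts)
  obtain T \<mu> where T\<mu>: "T\<mu> = (T, \<mu>)" by fastforce
  show ?case
  proof (rule independent_family_eigenspaces[OF Cons.prems(1), where T=T and \<mu>=\<mu>])
    show "T *v x i = \<mu> i *s x i" if "i \<in> I" for i
      using Cons.prems(2)[of T \<mu> i] that T\<mu> by simp
    show "independent_family {i \<in> I. \<mu> i = l} x" for l
    proof (rule Cons.IH)
      show "inj_on (\<lambda>i. map (\<lambda>(T, \<mu>). \<mu> i) Ts) {i \<in> I. \<mu> i = l}"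
        using Cons.prems(3) T\<mu> by (auto simp: inj_on_def)
    qed (use Cons.prems in auto)
  qed
qed

lemma independent_family_eigen_coefficients:
  fixes M :: "'a::field^'n^'n"
  assumes "finite I" "independent_family I x" "\<And>i. i \<in> I \<Longrightarrow> M *v x i = \<mu> i *s x i"
    and "M *v (\<Sum>i\<in>I. c i *s x i) = 0" "i \<in> I"
  shows "c i * \<mu> i = 0"
proof (rule independent_familyD[OF assms(2) _ assms(5)])
  have "M *v (\<Sum>i\<in>I. c i *s x i) = (\<Sum>i\<in>I. (c i * \<mu> i) *s x i)"
    using assms(3) by (simp add: vec.sum vec.scale vector_smult_assoc mult.commute cong: sum.cong)
  with assms(4) show "(\<Sum>i\<in>I. (c i * \<mu> i) *s x i) = 0" by simp
qed

section \<open>Strings of \<open>sl2\<close>-modules\<close>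

lemma of_nat_square_plus_double_inj:
  assumes "(of_nat m)\<^sup>2 + 2 * of_nat m = ((of_nat n)\<^sup>2 + 2 * of_nat n :: 'a::semiring_char_0)"
  shows "m = n"
proof -
  have mono: "strict_mono (\<lambda>k::nat. k\<^sup>2 + 2 * k)"
    by (rule strict_monoI) (simp add: add_strict_mono power_strict_mono)
  have "of_nat (m\<^sup>2 + 2 * m) = (of_nat (n\<^sup>2 + 2 * n) :: 'a)"
    using assms by simp
  then have "m\<^sup>2 + 2 * m = n\<^sup>2 + 2 * n"
    by (simp only: of_nat_eq_iff)
  then show ?thesis
    using strict_mono_eq[OF mono, of m n] by simp
qed

lemma of_nat_raise_coeff:
  assumes "Suc i \<le> P"
  shows "of_nat (Suc i * (P - Suc i + 1)) = (of_nat (Suc i) * (of_nat P - of_nat i) :: 'a::comm_ring_1)"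
proof -
  from assms have "P - Suc i + 1 = P - i" by simp
  with assms show ?thesis by (simp only: of_nat_mult of_nat_diff)
qed

lemma funpow_matrix_vector_mult_commute:
  fixes M N :: "'a::semiring_1^'n^'n"
  assumes "\<And>z. M *v (N *v z) = N *v (M *v z)"
  shows "M *v (((*v) N ^^ i) z) = ((*v) N ^^ i) (M *v z)"
  by (induction i) (simp_all add: assms)

lemma funpow_matrix_vector_mult_zero: "((*v) (N::'a::semiring_1^'n^'n) ^^ i) 0 = 0"
  by (induction i) simp_all

lemma funpow_matrix_vector_mult_scale:
  "((*v) (N::'a::field^'n^'n) ^^ i) (c *s z) = c *s ((*v) N ^^ i) z"
  by (induction i) (simp_all add: vec.scale)

lemma sl2_string_weight:
  fixes F H :: "'a::field^'n^'n"
  assumes HF: "\<And>z. H *v (F *v z) = F *v (H *v z) + (-2) *s (F *v z)"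
    and u: "H *v u = c *s u"
  shows "H *v (((*v) F ^^ i) u) = (c - 2 * of_nat i) *s ((*v) F ^^ i) u"
proof (induction i)
  case 0 then show ?case by (simp add: u)
next
  case (Suc i)
  show ?case using HF[of "((*v) F ^^ i) u"] Suc.IH by (simp add: vec.scale vec_eq_iff algebra_simps)
qed

lemma sl2_string_raise:
  fixes E F H :: "'a::field^'n^'n"
  assumes EF: "\<And>z. E *v (F *v z) = F *v (E *v z) + H *v z"
    and HF: "\<And>z. H *v (F *v z) = F *v (H *v z) + (-2) *s (F *v z)"
    and u: "E *v u = 0" "H *v u = c *s u"
  shows "E *v (((*v) F ^^ Suc i) u) = (of_nat (Suc i) * (c - of_nat i)) *s ((*v) F ^^ i) u"
proof (induction i)
  case 0 then show ?case by (simp add: EF u)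
next
  case (Suc i)
  have "E *v (((*v) F ^^ Suc (Suc i)) u)
      = F *v (E *v (((*v) F ^^ Suc i) u)) + H *v (((*v) F ^^ Suc i) u)"
    by (simp add: EF)
  also have "\<dots> = (of_nat (Suc (Suc i)) * (c - of_nat (Suc i))) *s ((*v) F ^^ Suc i) u"
    unfolding Suc sl2_string_weight[OF HF u(2)] by (simp add: vec.scale vec_eq_iff algebra_simps)
  finally show ?case .
qed

lemma sl2_string_finite:
  fixes E F H :: "'a::field_char_0^'n^'n"
  assumes EF: "\<And>z. E *v (F *v z) = F *v (E *v z) + H *v z"
    and HF: "\<And>z. H *v (F *v z) = F *v (H *v z) + (-2) *s (F *v z)"
    and u: "E *v u = 0" "H *v u = c *s u" "u \<noteq> 0"
  obtains m where "c = of_nat m" "((*v) F ^^ Suc m) u = 0" "\<And>i. i \<le> m \<Longrightarrow> ((*v) F ^^ i) u \<noteq> 0"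
proof -
  let ?f = "\<lambda>i. ((*v) F ^^ i) u"
  \<comment> \<open>Nonzero vectors \<open>F\<^sup>i u\<close> are \<open>H\<close>-eigenvectors for distinct eigenvalues, so there are at most
    \<open>CARD('n)\<close> of them.\<close>
  have "\<exists>k. ?f k = 0"
  proof (rule ccontr)
    assume "\<nexists>k. ?f k = 0"
    have "independent_family {..CARD('n)} ?f"
    proof (rule independent_family_eigenspaces[where T=H and \<mu>="\<lambda>i. c - 2 * of_nat i"])
      show "H *v ?f i = (c - 2 * of_nat i) *s ?f i" for i
        by (rule sl2_string_weight[OF HF u(2)])
      show "independent_family {i \<in> {..CARD('n)}. c - 2 * of_nat i = l} ?f" for l
        by (rule independent_family_subsingleton) (use \<open>\<nexists>k. ?f k = 0\<close> in auto)
    qed simp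
    then have "card (?f ` {..CARD('n)}) \<le> CARD('n)"
      using vec.independent_card_le_dim[OF subset_UNIV] independent_family_independent
      by (force simp: card_cart_basis)
    moreover have "card (?f ` {..CARD('n)}) = Suc CARD('n)"
      using \<open>independent_family {..CARD('n)} ?f\<close>
      by (simp add: card_image independent_family_inj_on)
    ultimately show False by simp
  qed
  define k where "k = (LEAST k. ?f k = 0)"
  have k: "?f k = 0" unfolding k_def using \<open>\<exists>k. ?f k = 0\<close> by (rule LeastI_ex)
  have below_k: "?f i \<noteq> 0" if "i < k" for i
    using that unfolding k_def by (rule not_less_Least)
  obtain m where m: "k = Suc m" using k u(3) by (cases k) auto
  have "(of_nat (Suc m) * (c - of_nat m)) *s ?f m = 0"
    using sl2_string_raise[OF EF HF u(1,2), of m] k m by simp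
  moreover have "?f m \<noteq> 0"
    using below_k m by auto
  ultimately have "c = of_nat m"
    using of_nat_neq_0[of m, where 'a='a] by (simp add: vec.scale_eq_0_iff del: of_nat_Suc)
  with that k m below_k show ?thesis by auto
qed

lemma sl2_string_finite_nat:
  fixes E F H :: "'a::field_char_0^'n^'n"
  assumes EF: "\<And>z. E *v (F *v z) = F *v (E *v z) + H *v z"
    and HF: "\<And>z. H *v (F *v z) = F *v (H *v z) + (-2) *s (F *v z)"
    and u: "E *v u = 0" "H *v u = of_nat P *s u" "u \<noteq> 0"
  shows "((*v) F ^^ Suc P) u = 0" and "i \<le> P \<Longrightarrow> ((*v) F ^^ i) u \<noteq> 0"
proof -
  obtain m where "of_nat P = (of_nat m :: 'a)" "((*v) F ^^ Suc m) u = 0"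
    "\<And>i. i \<le> m \<Longrightarrow> ((*v) F ^^ i) u \<noteq> 0"
    using sl2_string_finite[OF EF HF u] by blast
  moreover from this(1) have "m = P" by simp
  ultimately show "((*v) F ^^ Suc P) u = 0" and "i \<le> P \<Longrightarrow> ((*v) F ^^ i) u \<noteq> 0"
    by auto
qed

lemma sl2_string_casimir:
  fixes E F H :: "'a::field^'n^'n" and i :: nat
  assumes EF: "\<And>z. E *v (F *v z) = F *v (E *v z) + H *v z"
    and HF: "\<And>z. H *v (F *v z) = F *v (H *v z) + (-2) *s (F *v z)"
    and u: "E *v u = 0" "H *v u = c *s u"
  defines "x \<equiv> ((*v) F ^^ i) u"
  shows "2 *s (E *v (F *v x)) + 2 *s (F *v (E *v x)) + H *v (H *v x) = (c\<^sup>2 + 2 * c) *s x"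
proof -
  have EFx: "E *v (F *v x) = (of_nat (Suc i) * (c - of_nat i)) *s x"
    using sl2_string_raise[OF EF HF u, of i] by (simp add: x_def)
  have FEx: "F *v (E *v x) = (of_nat i * (c - of_nat i + 1)) *s x"
  proof (cases i)
    case 0 then show ?thesis by (simp add: x_def u)
  next
    case (Suc j)
    have "E *v x = (of_nat i * (c - of_nat j)) *s ((*v) F ^^ j) u"
      using sl2_string_raise[OF EF HF u, of j] Suc by (simp add: x_def)
    then have "F *v (E *v x) = (of_nat i * (c - of_nat j)) *s (F *v ((*v) F ^^ j) u)"
      by (simp only: vec.scale)
    also have "F *v ((*v) F ^^ j) u = x"
      by (simp add: x_def Suc)
    finally show ?thesis
      using Suc by (simp add: algebra_simps)
  qed
  have HHx: "H *v (H *v x) = ((c - 2 * of_nat i)\<^sup>2) *s x"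
    by (simp only: x_def sl2_string_weight[OF HF u(2)] vec.scale vector_smult_assoc power2_eq_square)
  show ?thesis
    unfolding EFx FEx HHx by (simp add: vec_eq_iff algebra_simps power2_eq_square)
qed

section \<open>The Lie algebra \<open>sp4\<close>\<close>

lemma Emat_nth: "Emat i j $ k $ l = (if k = idx4 i \<and> l = idx4 j then 1 else 0)"
  by (simp add: Emat_def)

lemma idx4_simps: "idx4 1 = 0" "idx4 (Suc 0) = 0" "idx4 2 = 1" "idx4 3 = 2" "idx4 4 = 3"
  by (simp_all add: idx4_def)

lemma forall_4: "(\<forall>i::4. P i) \<longleftrightarrow> P 0 \<and> P 1 \<and> P 2 \<and> P 3"
proof -
  have "(4::4) = 0" by simp
  then show ?thesis by (metis exhaust_4)
qed

lemma sum_UNIV_4: "sum f (UNIV :: 4 set) = f 0 + f 1 + f 2 + f 3"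
proof -
  have "f 4 = f 0" by (rule arg_cong[of _ _ f]) simp
  then show ?thesis using sum_4[of f] by (simp add: ac_simps)
qed

lemma transpose_add: "transpose (X + Y) = transpose X + transpose Y"
  by (simp add: transpose_def vec_eq_iff)

lemma matrix_add_rdistrib: "(B + C) ** A = B ** A + C ** A"
  by (simp add: matrix_matrix_mult_def vec_eq_iff sum.distrib[symmetric] algebra_simps)

lemma smul_matrix_vector_mult: "smul c M *v z = c *s (M *v z)"
  by (simp add: smul_def matrix_vector_mult_def vec_eq_iff sum_distrib_left mult.assoc)

text \<open>Root vectors of the short roots \<open>\<epsilon>\<^sub>1 - \<epsilon>\<^sub>2\<close> and
  \<open>\<epsilon>\<^sub>1 + \<epsilon>\<^sub>2\<close> and of their negatives. Together with the six
  generators of \<open>s_alg\<close> (roots \<open>\<plusminus>2\<epsilon>\<^sub>1\<close>,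
  \<open>\<plusminus>2\<epsilon>\<^sub>2\<close>) they form a basis of \<open>sp4\<close>.\<close>

definition e_minus :: "complex^4^4" where "e_minus = Emat 1 2 - Emat 4 3"
definition f_minus :: "complex^4^4" where "f_minus = Emat 2 1 - Emat 3 4"
definition e_plus :: "complex^4^4" where "e_plus = Emat 1 4 + Emat 2 3"
definition f_plus :: "complex^4^4" where "f_plus = Emat 4 1 + Emat 3 2"

lemmas sp4_basis_defs =
  h1_def h2_def e1_def e2_def f1_def f2_def e_minus_def f_minus_def e_plus_def f_plus_def

lemmas matrix_entry_simps =
  vec_eq_iff forall_4 matrix_matrix_mult_def sum_UNIV_4 smul_def sp4_basis_defs Emat_nth idx4_simps

lemma sp4_basis:
  "h1 \<in> sp4" "h2 \<in> sp4" "e1 \<in> sp4" "e2 \<in> sp4" "f1 \<in> sp4" "f2 \<in> sp4"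
  "e_minus \<in> sp4" "f_minus \<in> sp4" "e_plus \<in> sp4" "f_plus \<in> sp4"
  by (simp_all add: sp4_def Omega_def transpose_def matrix_entry_simps)

lemma sp4_add: "X \<in> sp4 \<Longrightarrow> Y \<in> sp4 \<Longrightarrow> X + Y \<in> sp4"
  by (simp add: sp4_def transpose_add matrix_add_ldistrib matrix_add_rdistrib algebra_simps)

lemma sp4_smul:
  assumes "X \<in> sp4"
  shows "smul c X \<in> sp4"
proof -
  have "transpose (smul c X) ** Omega + Omega ** smul c X = smul c (transpose X ** Omega + Omega ** X)"
    by (simp add: smul_def transpose_def matrix_matrix_mult_def vec_eq_iff sum_distrib_left algebra_simps)
  with assms show ?thesis by (simp add: sp4_def smul_def vec_eq_iff)
qed

lemma sp4_basis_expansion: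
  assumes "X \<in> sp4"
  shows "X = smul (X$0$0) h1 + smul (X$1$1) h2 + smul (X$0$2) e1 + smul (X$1$3) e2
           + smul (X$2$0) f1 + smul (X$3$1) f2 + smul (X$0$1) e_minus + smul (X$1$0) f_minus
           + smul (X$0$3) e_plus + smul (X$3$0) f_plus"
proof -
  have Omega: "Omega = (\<chi> i j. if i = 0 \<and> j = 2 \<or> i = 1 \<and> j = 3 then 1
                          else if i = 2 \<and> j = 0 \<or> i = 3 \<and> j = 1 then -1 else 0)"
    by (simp add: Omega_def vec_eq_iff forall_4 Emat_nth idx4_simps)
  have "(\<Sum>k\<in>UNIV. X$k$i * Omega$k$j) + (\<Sum>k\<in>UNIV. Omega$i$k * X$k$j) = 0" for i j
    using assms by (simp add: sp4_def matrix_matrix_mult_def transpose_def vec_eq_iff)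
  note entry = this[unfolded Omega sum_UNIV_4]
  have "X$2$2 = - X$0$0" "X$3$3 = - X$1$1" "X$3$2 = - X$0$1" "X$2$3 = - X$1$0"
    "X$1$2 = X$0$3" "X$2$1 = X$3$0"
    using entry[of 0 2] entry[of 1 3] entry[of 1 2] entry[of 0 3] entry[of 2 3] entry[of 0 1]
    by (simp_all add: eq_neg_iff_add_eq_0 add.commute)
  then show ?thesis
    by (simp add: vec_eq_iff forall_4 smul_def sp4_basis_defs Emat_nth idx4_simps)
qed

lemma sp4_brackets:
  "f2 ** f1 - f1 ** f2 = 0"
  "f_plus ** f1 - f1 ** f_plus = 0"
  "f_plus ** f2 - f2 ** f_plus = 0"
  "f_minus ** f1 - f1 ** f_minus = 0"
  "f_minus ** f2 - f2 ** f_minus = smul (-1) f_plus"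
  "f_minus ** f_plus - f_plus ** f_minus = smul (-2) f1"
  "e_minus ** f1 - f1 ** e_minus = smul (-1) f_plus"
  "e_minus ** f2 - f2 ** e_minus = 0"
  "e_minus ** f_plus - f_plus ** e_minus = smul (-2) f2"
  "e_minus ** f_minus - f_minus ** e_minus = smul 1 h1 + smul (-1) h2"
  "e_plus ** f1 - f1 ** e_plus = smul 1 f_minus"
  "e_plus ** f2 - f2 ** e_plus = smul 1 e_minus"
  "e_plus ** f_plus - f_plus ** e_plus = smul 1 h1 + smul 1 h2"
  "e_plus ** f_minus - f_minus ** e_plus = smul (-2) e2"
  "e_plus ** e_minus - e_minus ** e_plus = smul (-2) e1"
  "h1 ** f1 - f1 ** h1 = smul (-2) f1"
  "h1 ** f2 - f2 ** h1 = 0"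
  "h1 ** f_plus - f_plus ** h1 = smul (-1) f_plus"
  "h1 ** f_minus - f_minus ** h1 = smul (-1) f_minus"
  "h1 ** e_minus - e_minus ** h1 = smul 1 e_minus"
  "h1 ** e_plus - e_plus ** h1 = smul 1 e_plus"
  "h2 ** f1 - f1 ** h2 = 0"
  "h2 ** f2 - f2 ** h2 = smul (-2) f2"
  "h2 ** f_plus - f_plus ** h2 = smul (-1) f_plus"
  "h2 ** f_minus - f_minus ** h2 = smul 1 f_minus"
  "h2 ** e_minus - e_minus ** h2 = smul (-1) e_minus"
  "h2 ** e_plus - e_plus ** h2 = smul 1 e_plus"
  "h2 ** h1 - h1 ** h2 = 0"
  "e1 ** f1 - f1 ** e1 = smul 1 h1"
  "e1 ** f2 - f2 ** e1 = 0"
  "e1 ** f_plus - f_plus ** e1 = smul 1 e_minus"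
  "e1 ** f_minus - f_minus ** e1 = smul (-1) e_plus"
  "e1 ** e_minus - e_minus ** e1 = 0"
  "e1 ** e_plus - e_plus ** e1 = 0"
  "e1 ** h1 - h1 ** e1 = smul (-2) e1"
  "e1 ** h2 - h2 ** e1 = 0"
  "e2 ** f1 - f1 ** e2 = 0"
  "e2 ** f2 - f2 ** e2 = smul 1 h2"
  "e2 ** f_plus - f_plus ** e2 = smul 1 f_minus"
  "e2 ** f_minus - f_minus ** e2 = 0"
  "e2 ** e_minus - e_minus ** e2 = smul (-1) e_plus"
  "e2 ** e_plus - e_plus ** e2 = 0"
  "e2 ** h1 - h1 ** e2 = 0"
  "e2 ** h2 - h2 ** e2 = smul (-2) e2"
  "e2 ** e1 - e1 ** e2 = 0"
  by (simp_all add: matrix_entry_simps)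

lemma s_alg_generators: "e1 \<in> s_alg" "f1 \<in> s_alg" "h1 \<in> s_alg" "e2 \<in> s_alg" "f2 \<in> s_alg" "h2 \<in> s_alg"
proof -
  have comb: "smul c1 e1 + smul c2 f1 + smul c3 h1 + smul c4 e2 + smul c5 f2 + smul c6 h2 \<in> s_alg"
    for c1 c2 c3 c4 c5 c6
    unfolding s_alg_def by blast
  have "smul 1 X = X" "smul 0 X = 0" for X :: "complex^4^4"
    by (simp_all add: smul_def vec_eq_iff)
  then show "e1 \<in> s_alg" "f1 \<in> s_alg" "h1 \<in> s_alg" "e2 \<in> s_alg" "f2 \<in> s_alg" "h2 \<in> s_alg"
    using comb[of 1 0 0 0 0 0] comb[of 0 1 0 0 0 0] comb[of 0 0 1 0 0 0]
      comb[of 0 0 0 1 0 0] comb[of 0 0 0 0 1 0] comb[of 0 0 0 0 0 1]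
    by simp_all
qed

section \<open>Representations of \<open>sp4\<close> and \<open>s\<close>-primitive vectors\<close>

locale sp4_rep =
  fixes \<rho> :: "complex^4^4 \<Rightarrow> complex^'n^'n"
  assumes rep: "is_sp4_rep \<rho>"
begin

lemma rho_add: "X \<in> sp4 \<Longrightarrow> Y \<in> sp4 \<Longrightarrow> \<rho> (X + Y) = \<rho> X + \<rho> Y"
  using rep by (simp add: is_sp4_rep_def)

lemma rho_smul: "X \<in> sp4 \<Longrightarrow> \<rho> (smul c X) = smul c (\<rho> X)"
  using rep by (simp add: is_sp4_rep_def)

lemma rho_zero: "\<rho> 0 = 0"
proof -
  have "smul 0 h1 = 0" by (simp add: smul_def vec_eq_iff)
  then have "0 \<in> sp4" using sp4_smul[OF sp4_basis(1), of 0] by simp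
  then show ?thesis using rho_add[of 0 0] by simp
qed

lemma act_commutator:
  assumes "X \<in> sp4" "Y \<in> sp4"
  shows "\<rho> X *v (\<rho> Y *v z) = \<rho> Y *v (\<rho> X *v z) + \<rho> (X ** Y - Y ** X) *v z"
  using rep assms
  by (simp add: is_sp4_rep_def matrix_vector_mul_assoc matrix_vector_mult_diff_rdistrib)

text \<open>The action of the commutation relations of \<open>sp4\<close>, oriented so that rewriting with them
  brings products of generators into the order \<open>f1, f2, f_plus, f_minus, e_minus, e_plus, h1,
  h2, e1, e2\<close>.\<close>

lemma commutation_relations:
  "\<rho> f2 *v (\<rho> f1 *v z) = \<rho> f1 *v (\<rho> f2 *v z)"
  "\<rho> f_plus *v (\<rho> f1 *v z) = \<rho> f1 *v (\<rho> f_plus *v z)"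
  "\<rho> f_plus *v (\<rho> f2 *v z) = \<rho> f2 *v (\<rho> f_plus *v z)"
  "\<rho> f_minus *v (\<rho> f1 *v z) = \<rho> f1 *v (\<rho> f_minus *v z)"
  "\<rho> f_minus *v (\<rho> f2 *v z) = \<rho> f2 *v (\<rho> f_minus *v z) + ((-1) *s (\<rho> f_plus *v z))"
  "\<rho> f_minus *v (\<rho> f_plus *v z) = \<rho> f_plus *v (\<rho> f_minus *v z) + ((-2) *s (\<rho> f1 *v z))"
  "\<rho> e_minus *v (\<rho> f1 *v z) = \<rho> f1 *v (\<rho> e_minus *v z) + ((-1) *s (\<rho> f_plus *v z))"
  "\<rho> e_minus *v (\<rho> f2 *v z) = \<rho> f2 *v (\<rho> e_minus *v z)"
  "\<rho> e_minus *v (\<rho> f_plus *v z) = \<rho> f_plus *v (\<rho> e_minus *v z) + ((-2) *s (\<rho> f2 *v z))"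
  "\<rho> e_minus *v (\<rho> f_minus *v z) = \<rho> f_minus *v (\<rho> e_minus *v z) + (1 *s (\<rho> h1 *v z) + (-1) *s (\<rho> h2 *v z))"
  "\<rho> e_plus *v (\<rho> f1 *v z) = \<rho> f1 *v (\<rho> e_plus *v z) + (1 *s (\<rho> f_minus *v z))"
  "\<rho> e_plus *v (\<rho> f2 *v z) = \<rho> f2 *v (\<rho> e_plus *v z) + (1 *s (\<rho> e_minus *v z))"
  "\<rho> e_plus *v (\<rho> f_plus *v z) = \<rho> f_plus *v (\<rho> e_plus *v z) + (1 *s (\<rho> h1 *v z) + 1 *s (\<rho> h2 *v z))"
  "\<rho> e_plus *v (\<rho> f_minus *v z) = \<rho> f_minus *v (\<rho> e_plus *v z) + ((-2) *s (\<rho> e2 *v z))"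
  "\<rho> e_plus *v (\<rho> e_minus *v z) = \<rho> e_minus *v (\<rho> e_plus *v z) + ((-2) *s (\<rho> e1 *v z))"
  "\<rho> h1 *v (\<rho> f1 *v z) = \<rho> f1 *v (\<rho> h1 *v z) + ((-2) *s (\<rho> f1 *v z))"
  "\<rho> h1 *v (\<rho> f2 *v z) = \<rho> f2 *v (\<rho> h1 *v z)"
  "\<rho> h1 *v (\<rho> f_plus *v z) = \<rho> f_plus *v (\<rho> h1 *v z) + ((-1) *s (\<rho> f_plus *v z))"
  "\<rho> h1 *v (\<rho> f_minus *v z) = \<rho> f_minus *v (\<rho> h1 *v z) + ((-1) *s (\<rho> f_minus *v z))"
  "\<rho> h1 *v (\<rho> e_minus *v z) = \<rho> e_minus *v (\<rho> h1 *v z) + (1 *s (\<rho> e_minus *v z))"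
  "\<rho> h1 *v (\<rho> e_plus *v z) = \<rho> e_plus *v (\<rho> h1 *v z) + (1 *s (\<rho> e_plus *v z))"
  "\<rho> h2 *v (\<rho> f1 *v z) = \<rho> f1 *v (\<rho> h2 *v z)"
  "\<rho> h2 *v (\<rho> f2 *v z) = \<rho> f2 *v (\<rho> h2 *v z) + ((-2) *s (\<rho> f2 *v z))"
  "\<rho> h2 *v (\<rho> f_plus *v z) = \<rho> f_plus *v (\<rho> h2 *v z) + ((-1) *s (\<rho> f_plus *v z))"
  "\<rho> h2 *v (\<rho> f_minus *v z) = \<rho> f_minus *v (\<rho> h2 *v z) + (1 *s (\<rho> f_minus *v z))"
  "\<rho> h2 *v (\<rho> e_minus *v z) = \<rho> e_minus *v (\<rho> h2 *v z) + ((-1) *s (\<rho> e_minus *v z))"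
  "\<rho> h2 *v (\<rho> e_plus *v z) = \<rho> e_plus *v (\<rho> h2 *v z) + (1 *s (\<rho> e_plus *v z))"
  "\<rho> h2 *v (\<rho> h1 *v z) = \<rho> h1 *v (\<rho> h2 *v z)"
  "\<rho> e1 *v (\<rho> f1 *v z) = \<rho> f1 *v (\<rho> e1 *v z) + (1 *s (\<rho> h1 *v z))"
  "\<rho> e1 *v (\<rho> f2 *v z) = \<rho> f2 *v (\<rho> e1 *v z)"
  "\<rho> e1 *v (\<rho> f_plus *v z) = \<rho> f_plus *v (\<rho> e1 *v z) + (1 *s (\<rho> e_minus *v z))"
  "\<rho> e1 *v (\<rho> f_minus *v z) = \<rho> f_minus *v (\<rho> e1 *v z) + ((-1) *s (\<rho> e_plus *v z))"
  "\<rho> e1 *v (\<rho> e_minus *v z) = \<rho> e_minus *v (\<rho> e1 *v z)"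
  "\<rho> e1 *v (\<rho> e_plus *v z) = \<rho> e_plus *v (\<rho> e1 *v z)"
  "\<rho> e1 *v (\<rho> h1 *v z) = \<rho> h1 *v (\<rho> e1 *v z) + ((-2) *s (\<rho> e1 *v z))"
  "\<rho> e1 *v (\<rho> h2 *v z) = \<rho> h2 *v (\<rho> e1 *v z)"
  "\<rho> e2 *v (\<rho> f1 *v z) = \<rho> f1 *v (\<rho> e2 *v z)"
  "\<rho> e2 *v (\<rho> f2 *v z) = \<rho> f2 *v (\<rho> e2 *v z) + (1 *s (\<rho> h2 *v z))"
  "\<rho> e2 *v (\<rho> f_plus *v z) = \<rho> f_plus *v (\<rho> e2 *v z) + (1 *s (\<rho> f_minus *v z))"
  "\<rho> e2 *v (\<rho> f_minus *v z) = \<rho> f_minus *v (\<rho> e2 *v z)"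
  "\<rho> e2 *v (\<rho> e_minus *v z) = \<rho> e_minus *v (\<rho> e2 *v z) + ((-1) *s (\<rho> e_plus *v z))"
  "\<rho> e2 *v (\<rho> e_plus *v z) = \<rho> e_plus *v (\<rho> e2 *v z)"
  "\<rho> e2 *v (\<rho> h1 *v z) = \<rho> h1 *v (\<rho> e2 *v z)"
  "\<rho> e2 *v (\<rho> h2 *v z) = \<rho> h2 *v (\<rho> e2 *v z) + ((-2) *s (\<rho> e2 *v z))"
  "\<rho> e2 *v (\<rho> e1 *v z) = \<rho> e1 *v (\<rho> e2 *v z)"
  by (rule trans[OF act_commutator];
      simp add: sp4_basis sp4_brackets sp4_smul sp4_add rho_add rho_smul rho_zero
        smul_matrix_vector_mult matrix_vector_mult_add_rdistrib)+

lemma act_sp4_expansion: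
  assumes "X \<in> sp4"
  shows "\<rho> X *v z = X$0$0 *s (\<rho> h1 *v z) + X$1$1 *s (\<rho> h2 *v z) + X$0$2 *s (\<rho> e1 *v z)
    + X$1$3 *s (\<rho> e2 *v z) + X$2$0 *s (\<rho> f1 *v z) + X$3$1 *s (\<rho> f2 *v z)
    + X$0$1 *s (\<rho> e_minus *v z) + X$1$0 *s (\<rho> f_minus *v z)
    + X$0$3 *s (\<rho> e_plus *v z) + X$3$0 *s (\<rho> f_plus *v z)"
  by (subst sp4_basis_expansion[OF assms])
    (simp add: rho_add rho_smul sp4_add sp4_smul sp4_basis smul_matrix_vector_mult
      matrix_vector_mult_add_rdistrib)

lemma invariant_under_sp4I:
  assumes "vec.subspace W"
    and "\<And>G w. G \<in> {h1, h2, e1, e2, f1, f2, e_minus, f_minus, e_plus, f_plus} \<Longrightarrow> w \<in> W \<Longrightarrow> \<rho> G *v w \<in> W"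
  shows "invariant_under \<rho> sp4 W"
  unfolding invariant_under_def
proof (intro ballI)
  fix X w assume "X \<in> sp4" "w \<in> W"
  then show "\<rho> X *v w \<in> W"
    unfolding act_sp4_expansion[OF \<open>X \<in> sp4\<close>]
    by (intro vec.subspace_add[OF assms(1)] vec.subspace_scale[OF assms(1)] assms(2)) auto
qed

lemma act_s_alg_expansion:
  assumes "X \<in> s_alg"
  obtains c1 c2 c3 c4 c5 c6 where "\<And>z. \<rho> X *v z = c1 *s (\<rho> e1 *v z) + c2 *s (\<rho> f1 *v z)
    + c3 *s (\<rho> h1 *v z) + c4 *s (\<rho> e2 *v z) + c5 *s (\<rho> f2 *v z) + c6 *s (\<rho> h2 *v z)"
proof -
  obtain c1 c2 c3 c4 c5 c6 where
    "X = smul c1 e1 + smul c2 f1 + smul c3 h1 + smul c4 e2 + smul c5 f2 + smul c6 h2"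
    using assms by (auto simp: s_alg_def)
  then show ?thesis
    by (intro that[of c1 c2 c3 c4 c5 c6])
      (simp add: rho_add rho_smul sp4_add sp4_smul sp4_basis smul_matrix_vector_mult
        matrix_vector_mult_add_rdistrib)
qed

lemma invariant_under_s_algI:
  assumes "vec.subspace W"
    and "\<And>G w. G \<in> {e1, f1, h1, e2, f2, h2} \<Longrightarrow> w \<in> W \<Longrightarrow> \<rho> G *v w \<in> W"
  shows "invariant_under \<rho> s_alg W"
  unfolding invariant_under_def
proof (intro ballI)
  fix X w assume "X \<in> s_alg" "w \<in> W"
  obtain c1 c2 c3 c4 c5 c6 where "\<And>z. \<rho> X *v z = c1 *s (\<rho> e1 *v z) + c2 *s (\<rho> f1 *v z)
    + c3 *s (\<rho> h1 *v z) + c4 *s (\<rho> e2 *v z) + c5 *s (\<rho> f2 *v z) + c6 *s (\<rho> h2 *v z)"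
    using act_s_alg_expansion[OF \<open>X \<in> s_alg\<close>] by blast
  with \<open>w \<in> W\<close> show "\<rho> X *v w \<in> W"
    by (simp only:) (intro vec.subspace_add[OF assms(1)] vec.subspace_scale[OF assms(1)] assms(2); simp)
qed

lemma s_alg_annihilates_iff:
  "(\<forall>X\<in>s_alg. \<rho> X *v w = 0) \<longleftrightarrow>
     \<rho> e1 *v w = 0 \<and> \<rho> f1 *v w = 0 \<and> \<rho> h1 *v w = 0 \<and> \<rho> e2 *v w = 0 \<and> \<rho> f2 *v w = 0 \<and> \<rho> h2 *v w = 0"
proof
  assume "\<forall>X\<in>s_alg. \<rho> X *v w = 0"
  then show "\<rho> e1 *v w = 0 \<and> \<rho> f1 *v w = 0 \<and> \<rho> h1 *v w = 0 \<and> \<rho> e2 *v w = 0 \<and> \<rho> f2 *v w = 0 \<and> \<rho> h2 *v w = 0"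
    using s_alg_generators by blast
next
  assume killed: "\<rho> e1 *v w = 0 \<and> \<rho> f1 *v w = 0 \<and> \<rho> h1 *v w = 0 \<and> \<rho> e2 *v w = 0 \<and> \<rho> f2 *v w = 0 \<and> \<rho> h2 *v w = 0"
  show "\<forall>X\<in>s_alg. \<rho> X *v w = 0"
  proof
    fix X assume "X \<in> s_alg"
    then obtain c1 c2 c3 c4 c5 c6 where "\<And>z. \<rho> X *v z = c1 *s (\<rho> e1 *v z) + c2 *s (\<rho> f1 *v z)
      + c3 *s (\<rho> h1 *v z) + c4 *s (\<rho> e2 *v z) + c5 *s (\<rho> f2 *v z) + c6 *s (\<rho> h2 *v z)"
      using act_s_alg_expansion by blast
    with killed show "\<rho> X *v w = 0" by simp
  qed
qed

lemmas action_linearity =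
  matrix_vector_right_distrib matrix_vector_mult_diff_distrib vec.scale matrix_vector_mult_0_right

definition s_primitive :: "complex \<Rightarrow> complex \<Rightarrow> complex^'n \<Rightarrow> bool" where
  "s_primitive p q w \<longleftrightarrow>
     \<rho> e1 *v w = 0 \<and> \<rho> e2 *v w = 0 \<and> \<rho> h1 *v w = p *s w \<and> \<rho> h2 *v w = q *s w"

lemma s_primitiveD:
  assumes "s_primitive p q w"
  shows "\<rho> e1 *v w = 0" "\<rho> e2 *v w = 0" "\<rho> h1 *v w = p *s w" "\<rho> h2 *v w = q *s w"
  using assms by (simp_all add: s_primitive_def)

text \<open>Corrections of \<open>\<rho> f_minus w\<close>, \<open>\<rho> e_minus w\<close>, \<open>\<rho> f_plus w\<close> by terms lowered by \<open>f1\<close>, \<open>f2\<close>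
  that make them \<open>s\<close>-primitive again when \<open>w\<close> is \<open>s\<close>-primitive of weight \<open>(p, q)\<close>.\<close>

definition prim_f_minus :: "complex \<Rightarrow> complex^'n \<Rightarrow> complex^'n" where
  "prim_f_minus p w = (p + 1) *s (\<rho> f_minus *v w) + \<rho> f1 *v (\<rho> e_plus *v w)"

definition prim_e_minus :: "complex \<Rightarrow> complex^'n \<Rightarrow> complex^'n" where
  "prim_e_minus q w = (q + 1) *s (\<rho> e_minus *v w) + \<rho> f2 *v (\<rho> e_plus *v w)"

definition prim_f_plus :: "complex \<Rightarrow> complex \<Rightarrow> complex^'n \<Rightarrow> complex^'n" where
  "prim_f_plus p q w = ((p + 1) * (q + 1)) *s (\<rho> f_plus *v w) - (q + 1) *s (\<rho> f1 *v (\<rho> e_minus *v w))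
     - (p + 1) *s (\<rho> f2 *v (\<rho> f_minus *v w)) - \<rho> f1 *v (\<rho> f2 *v (\<rho> e_plus *v w))"

lemma prim_f_minus_zero: "prim_f_minus p 0 = 0"
  by (simp add: prim_f_minus_def)

lemma prim_f_plus_zero: "prim_f_plus p q 0 = 0"
  by (simp add: prim_f_plus_def)

lemma prim_f_plus_scale: "prim_f_plus p q (c *s x) = c *s prim_f_plus p q x"
  unfolding prim_f_plus_def by (simp only: action_linearity) (simp add: vec_eq_iff algebra_simps)

definition casimir :: "complex^'n \<Rightarrow> complex^'n" where
  "casimir z = 2 *s (\<rho> e1 *v (\<rho> f1 *v z)) + 2 *s (\<rho> f1 *v (\<rho> e1 *v z))
     + 2 *s (\<rho> e2 *v (\<rho> f2 *v z)) + 2 *s (\<rho> f2 *v (\<rho> e2 *v z))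
     + \<rho> h1 *v (\<rho> h1 *v z) + \<rho> h2 *v (\<rho> h2 *v z)
     + \<rho> e_minus *v (\<rho> f_minus *v z) + \<rho> f_minus *v (\<rho> e_minus *v z)
     + \<rho> e_plus *v (\<rho> f_plus *v z) + \<rho> f_plus *v (\<rho> e_plus *v z)"

lemma s_primitive_prim_f_plus:
  assumes "s_primitive p q w"
  shows "s_primitive (p - 1) (q - 1) (prim_f_plus p q w)"
  unfolding s_primitive_def prim_f_plus_def
  by (intro conjI; simp only: action_linearity commutation_relations s_primitiveD[OF assms];
      simp add: vec_eq_iff algebra_simps)

lemma s_primitive_prim_f_minus:
  assumes "s_primitive p q w"
  shows "s_primitive (p - 1) (q + 1) (prim_f_minus p w)"
  unfolding s_primitive_def prim_f_minus_def
  by (intro conjI; simp only: action_linearity commutation_relations s_primitiveD[OF assms];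
      simp add: vec_eq_iff algebra_simps)

lemma prim_f_minus_prim_f_plus:
  assumes "s_primitive p q w"
  shows "prim_f_minus (p - 1) (prim_f_plus p q w) = prim_f_plus (p - 1) (q + 1) (prim_f_minus p w)"
  unfolding prim_f_minus_def prim_f_plus_def
  by (simp only: action_linearity commutation_relations s_primitiveD[OF assms])
    (simp add: vec_eq_iff algebra_simps)

lemma prim_e_minus_prim_f_plus:
  assumes "s_primitive p q w"
  shows "prim_e_minus (q - 1) (prim_f_plus p q w) = prim_f_plus (p + 1) (q - 1) (prim_e_minus q w)"
  unfolding prim_e_minus_def prim_f_plus_def
  by (simp only: action_linearity commutation_relations s_primitiveD[OF assms])
    (simp add: vec_eq_iff algebra_simps)

lemma e_plus_prim_f_minus:
  assumes "s_primitive p q w"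
  shows "\<rho> e_plus *v prim_f_minus p w = prim_f_minus (p + 1) (\<rho> e_plus *v w)"
  unfolding prim_f_minus_def
  by (simp only: action_linearity commutation_relations s_primitiveD[OF assms])
    (simp add: vec_eq_iff algebra_simps)

lemma e_plus_prim_f_plus:
  assumes "s_primitive p q w"
  shows "\<rho> e_plus *v prim_f_plus p q w = prim_f_plus (p + 1) (q + 1) (\<rho> e_plus *v w)
    + (p + q + 2) *s ((q * (p + 1)) *s w
                      - (\<rho> f_plus *v (\<rho> e_plus *v w) + \<rho> f_minus *v (\<rho> e_minus *v w)))"
  unfolding prim_f_plus_def
  by (simp only: action_linearity commutation_relations s_primitiveD[OF assms])
    (simp add: vec_eq_iff algebra_simps)

lemma casimir_s_primitive:
  assumes "s_primitive p q w"
  shows "casimir w = (p\<^sup>2 + q\<^sup>2 + 4 * p + 2 * q) *s w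
    + 2 *s (\<rho> f_plus *v (\<rho> e_plus *v w) + \<rho> f_minus *v (\<rho> e_minus *v w))"
  unfolding casimir_def
  by (simp only: action_linearity commutation_relations s_primitiveD[OF assms])
    (simp add: vec_eq_iff algebra_simps power2_eq_square)

lemma casimir_add: "casimir (x + y) = casimir x + casimir y"
  unfolding casimir_def by (simp only: action_linearity) (simp add: vec_eq_iff algebra_simps)

lemma casimir_scale: "casimir (c *s x) = c *s casimir x"
  unfolding casimir_def by (simp only: action_linearity) (simp add: vec_eq_iff algebra_simps)

lemma casimir_act_basis:
  "casimir (\<rho> h1 *v z) = \<rho> h1 *v casimir z" "casimir (\<rho> h2 *v z) = \<rho> h2 *v casimir z"
  "casimir (\<rho> e1 *v z) = \<rho> e1 *v casimir z" "casimir (\<rho> e2 *v z) = \<rho> e2 *v casimir z"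
  "casimir (\<rho> f1 *v z) = \<rho> f1 *v casimir z" "casimir (\<rho> f2 *v z) = \<rho> f2 *v casimir z"
  "casimir (\<rho> e_minus *v z) = \<rho> e_minus *v casimir z" "casimir (\<rho> f_minus *v z) = \<rho> f_minus *v casimir z"
  "casimir (\<rho> e_plus *v z) = \<rho> e_plus *v casimir z" "casimir (\<rho> f_plus *v z) = \<rho> f_plus *v casimir z"
  unfolding casimir_def
  by (simp only: action_linearity commutation_relations; simp add: vec_eq_iff algebra_simps)+

lemma casimir_act:
  assumes "X \<in> sp4"
  shows "casimir (\<rho> X *v z) = \<rho> X *v casimir z"
  unfolding act_sp4_expansion[OF assms] by (simp add: casimir_add casimir_scale casimir_act_basis)

section \<open>The \<open>s\<close>-module generated by an \<open>s\<close>-primitive vector\<close>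

lemma sl2_relations_1:
  "\<rho> e1 *v (\<rho> f1 *v z) = \<rho> f1 *v (\<rho> e1 *v z) + \<rho> h1 *v z"
  "\<rho> h1 *v (\<rho> f1 *v z) = \<rho> f1 *v (\<rho> h1 *v z) + (-2) *s (\<rho> f1 *v z)"
  by (simp_all add: commutation_relations)

lemma sl2_relations_2:
  "\<rho> e2 *v (\<rho> f2 *v z) = \<rho> f2 *v (\<rho> e2 *v z) + \<rho> h2 *v z"
  "\<rho> h2 *v (\<rho> f2 *v z) = \<rho> f2 *v (\<rho> h2 *v z) + (-2) *s (\<rho> f2 *v z)"
  by (simp_all add: commutation_relations)

lemma sl2_relations_minus:
  "\<rho> e_minus *v (\<rho> f_minus *v z) = \<rho> f_minus *v (\<rho> e_minus *v z) + (\<rho> h1 - \<rho> h2) *v z"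
  "(\<rho> h1 - \<rho> h2) *v (\<rho> f_minus *v z)
     = \<rho> f_minus *v ((\<rho> h1 - \<rho> h2) *v z) + (-2) *s (\<rho> f_minus *v z)"
  by (simp_all add: commutation_relations matrix_vector_mult_diff_rdistrib
      matrix_vector_mult_diff_distrib vec_eq_iff algebra_simps)

definition string_vec :: "complex^'n \<Rightarrow> nat \<Rightarrow> nat \<Rightarrow> complex^'n" where
  "string_vec w i j = ((*v) (\<rho> f1) ^^ i) (((*v) (\<rho> f2) ^^ j) w)"

lemma string_vec_swap: "string_vec w i j = ((*v) (\<rho> f2) ^^ j) (((*v) (\<rho> f1) ^^ i) w)"
proof -
  have "((*v) (\<rho> f1) ^^ i) (\<rho> f2 *v z) = \<rho> f2 *v ((*v) (\<rho> f1) ^^ i) z" for z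
    by (rule funpow_matrix_vector_mult_commute[symmetric]) (simp add: commutation_relations)
  then show ?thesis
    unfolding string_vec_def by (induction j) simp_all
qed

lemma s_primitive_other_lowering:
  assumes "s_primitive p q w"
  shows "\<rho> e1 *v ((*v) (\<rho> f2) ^^ j) w = 0" "\<rho> h1 *v ((*v) (\<rho> f2) ^^ j) w = p *s ((*v) (\<rho> f2) ^^ j) w"
    "\<rho> e2 *v ((*v) (\<rho> f1) ^^ i) w = 0" "\<rho> h2 *v ((*v) (\<rho> f1) ^^ i) w = q *s ((*v) (\<rho> f1) ^^ i) w"
  using s_primitiveD[OF assms]
  by (simp_all add: funpow_matrix_vector_mult_commute commutation_relations
      funpow_matrix_vector_mult_zero funpow_matrix_vector_mult_scale)

lemma act_f1_string_vec: "\<rho> f1 *v string_vec w i j = string_vec w (Suc i) j"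
  by (simp add: string_vec_def)

lemma act_f2_string_vec: "\<rho> f2 *v string_vec w i j = string_vec w i (Suc j)"
  by (simp add: string_vec_swap)

lemma act_h1_string_vec:
  "s_primitive p q w \<Longrightarrow> \<rho> h1 *v string_vec w i j = (p - 2 * of_nat i) *s string_vec w i j"
  unfolding string_vec_def
  by (rule sl2_string_weight[OF sl2_relations_1(2) s_primitive_other_lowering(2)])

lemma act_h2_string_vec:
  "s_primitive p q w \<Longrightarrow> \<rho> h2 *v string_vec w i j = (q - 2 * of_nat j) *s string_vec w i j"
  unfolding string_vec_swap
  by (rule sl2_string_weight[OF sl2_relations_2(2) s_primitive_other_lowering(4)])

lemma act_e1_string_vec:
  assumes "s_primitive p q w"
  shows "\<rho> e1 *v string_vec w (Suc i) j = (of_nat (Suc i) * (p - of_nat i)) *s string_vec w i j"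
    and "\<rho> e1 *v string_vec w 0 j = 0"
  unfolding string_vec_def
  by (rule sl2_string_raise[OF sl2_relations_1 s_primitive_other_lowering(1,2)[OF assms]])
    (simp add: s_primitive_other_lowering(1)[OF assms])

lemma act_e2_string_vec:
  assumes "s_primitive p q w"
  shows "\<rho> e2 *v string_vec w i (Suc j) = (of_nat (Suc j) * (q - of_nat j)) *s string_vec w i j"
    and "\<rho> e2 *v string_vec w i 0 = 0"
  unfolding string_vec_swap
  by (rule sl2_string_raise[OF sl2_relations_2 s_primitive_other_lowering(3,4)[OF assms]])
    (simp add: s_primitive_other_lowering(3)[OF assms])

lemma string_vec_natural:
  assumes "s_primitive (of_nat P) (of_nat Q) w" "w \<noteq> 0"
  shows "string_vec w (Suc P) j = 0" and "string_vec w i (Suc Q) = 0"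
    and "i \<le> P \<Longrightarrow> j \<le> Q \<Longrightarrow> string_vec w i j \<noteq> 0"
proof -
  note w = s_primitiveD[OF assms(1)]
  note f2_string = sl2_string_finite_nat[OF sl2_relations_2 w(2,4) assms(2)]
  have f1_string: "((*v) (\<rho> f1) ^^ Suc P) (((*v) (\<rho> f2) ^^ j) w) = 0"
    "i \<le> P \<Longrightarrow> ((*v) (\<rho> f1) ^^ i) (((*v) (\<rho> f2) ^^ j) w) \<noteq> 0"
    if "j \<le> Q" for i j
    using sl2_string_finite_nat[OF sl2_relations_1 s_primitive_other_lowering(1,2)[OF assms(1)]
        f2_string(2)[OF that]] by blast+
  have "((*v) (\<rho> f2) ^^ j) w = 0" if "\<not> j \<le> Q" for j
  proof -
    have "((*v) (\<rho> f2) ^^ ((j - Suc Q) + Suc Q)) w = 0"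
      by (simp only: funpow_add comp_apply f2_string(1) funpow_matrix_vector_mult_zero)
    with that show ?thesis by simp
  qed
  with f1_string(1) show "string_vec w (Suc P) j = 0"
    unfolding string_vec_def by (cases "j \<le> Q") (simp_all add: funpow_matrix_vector_mult_zero)
  show "string_vec w i (Suc Q) = 0"
    by (simp add: string_vec_def f2_string(1) funpow_matrix_vector_mult_zero del: funpow.simps)
  show "i \<le> P \<Longrightarrow> j \<le> Q \<Longrightarrow> string_vec w i j \<noteq> 0"
    unfolding string_vec_def by (rule f1_string(2))
qed

definition string_block :: "complex^'n \<Rightarrow> nat \<Rightarrow> nat \<Rightarrow> (complex^'n) set" where
  "string_block w P Q = vec.span ((\<lambda>(i, j). string_vec w i j) ` ({..P} \<times> {..Q}))"

lemma string_vec_in_block: "i \<le> P \<Longrightarrow> j \<le> Q \<Longrightarrow> string_vec w i j \<in> string_block w P Q"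
  unfolding string_block_def by (rule vec.span_base) force

lemma act_s_string_vec_in_block:
  assumes "s_primitive (of_nat P) (of_nat Q) w" "w \<noteq> 0"
    and "G \<in> {e1, f1, h1, e2, f2, h2}" "i \<le> P" "j \<le> Q"
  shows "\<rho> G *v string_vec w i j \<in> string_block w P Q"
proof -
  have scaled: "c *s string_vec w i' j' \<in> string_block w P Q" if "i' \<le> P" "j' \<le> Q" for c i' j'
    unfolding string_block_def
    using string_vec_in_block[OF that, unfolded string_block_def] by (rule vec.span_scale)
  have zero: "0 \<in> string_block w P Q"
    unfolding string_block_def by (rule vec.span_zero)
  from assms(3) show ?thesis
  proof (elim insertE emptyE)
    assume "G = e1" then show ?thesis
      using act_e1_string_vec[OF assms(1)] scaled zero assms(4,5) by (cases i) auto
  next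
    assume "G = e2" then show ?thesis
      using act_e2_string_vec[OF assms(1)] scaled zero assms(4,5) by (cases j) auto
  next
    assume "G = h1" then show ?thesis
      using scaled[OF assms(4,5), of "of_nat P - 2 * of_nat i"] by (simp add: act_h1_string_vec[OF assms(1)])
  next
    assume "G = h2" then show ?thesis
      using scaled[OF assms(4,5), of "of_nat Q - 2 * of_nat j"] by (simp add: act_h2_string_vec[OF assms(1)])
  next
    assume "G = f1" then show ?thesis
      using act_f1_string_vec string_vec_natural(1)[OF assms(1,2)] string_vec_in_block zero assms(4,5)
      by (cases "i = P") auto
  next
    assume "G = f2" then show ?thesis
      using act_f2_string_vec string_vec_natural(2)[OF assms(1,2)] string_vec_in_block zero assms(4,5)
      by (cases "j = Q") auto
  qed
qed

lemma string_block_invariant: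
  assumes "s_primitive (of_nat P) (of_nat Q) w" "w \<noteq> 0"
  shows "invariant_under \<rho> s_alg (string_block w P Q)"
proof (rule invariant_under_s_algI)
  show "vec.subspace (string_block w P Q)"
    unfolding string_block_def by simp
  fix G z assume G: "G \<in> {e1, f1, h1, e2, f2, h2}" and z: "z \<in> string_block w P Q"
  from z show "\<rho> G *v z \<in> string_block w P Q"
    unfolding string_block_def
  proof (rule matrix_vector_mult_span_closed[rotated])
    fix x assume "x \<in> (\<lambda>(i, j). string_vec w i j) ` ({..P} \<times> {..Q})"
    then obtain i j where "i \<le> P" "j \<le> Q" "x = string_vec w i j" by auto
    then show "\<rho> G *v x \<in> vec.span ((\<lambda>(i, j). string_vec w i j) ` ({..P} \<times> {..Q}))"
      using act_s_string_vec_in_block[OF assms G] by (simp add: string_block_def)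
  qed
qed

lemma string_block_independent:
  assumes "s_primitive (of_nat P) (of_nat Q) w" "w \<noteq> 0"
  shows "independent_family ({..P} \<times> {..Q}) (\<lambda>(i, j). string_vec w i j)"
proof (rule independent_family_eigenspaces
    [where T="\<rho> h1" and \<mu>="\<lambda>ij. of_nat P - 2 * of_nat (fst ij)"])
  let ?x = "\<lambda>(i, j). string_vec w i j"
  show "\<rho> h1 *v ?x ij = (of_nat P - 2 * of_nat (fst ij)) *s ?x ij" for ij
    by (cases ij) (simp add: act_h1_string_vec[OF assms(1)])
  show "independent_family {ij \<in> {..P} \<times> {..Q}. of_nat P - 2 * of_nat (fst ij) = (l::complex)} ?x" for l
  proof (rule independent_family_eigenspaces
      [where T="\<rho> h2" and \<mu>="\<lambda>ij. of_nat Q - 2 * of_nat (snd ij)"])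
    show "\<rho> h2 *v ?x ij = (of_nat Q - 2 * of_nat (snd ij)) *s ?x ij" for ij
      by (cases ij) (simp add: act_h2_string_vec[OF assms(1)])
    show "independent_family {ij \<in> {ij \<in> {..P} \<times> {..Q}. of_nat P - 2 * of_nat (fst ij) = (l::complex)}.
        of_nat Q - 2 * of_nat (snd ij) = (l'::complex)} ?x" for l'
      by (rule independent_family_subsingleton) (auto simp: string_vec_natural(3)[OF assms])
  qed simp
qed simp

lemma string_block_is_LpLq:
  assumes "s_primitive (of_nat P) (of_nat Q) w" "w \<noteq> 0"
  shows "is_LpLq \<rho> (string_block w P Q) P Q"
  unfolding is_LpLq_def
proof (intro exI[of _ "\<lambda>(i, j). string_vec w i j"] conjI allI impI)
  note indep = string_block_independent[OF assms]
  show "inj_on (\<lambda>(i, j). string_vec w i j) ({..P} \<times> {..Q})"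
    using independent_family_inj_on[OF _ indep] by simp
  show "vec.independent ((\<lambda>(i, j). string_vec w i j) ` ({..P} \<times> {..Q}))"
    using independent_family_independent[OF _ indep] by simp
  show "vec.span ((\<lambda>(i, j). string_vec w i j) ` ({..P} \<times> {..Q})) = string_block w P Q"
    by (simp add: string_block_def)
  fix i j assume i: "i \<le> P" and j: "j \<le> Q"
  show "\<rho> h1 *v (case (i, j) of (i, j) \<Rightarrow> string_vec w i j)
      = of_int (int P - 2 * int i) *s (case (i, j) of (i, j) \<Rightarrow> string_vec w i j)"
    by (simp add: act_h1_string_vec[OF assms(1)])
  show "\<rho> h2 *v (case (i, j) of (i, j) \<Rightarrow> string_vec w i j)
      = of_int (int Q - 2 * int j) *s (case (i, j) of (i, j) \<Rightarrow> string_vec w i j)"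
    by (simp add: act_h2_string_vec[OF assms(1)])
  show "\<rho> f1 *v (case (i, j) of (i, j) \<Rightarrow> string_vec w i j)
      = (if i < P then case (i + 1, j) of (i, j) \<Rightarrow> string_vec w i j else 0)"
    using i string_vec_natural(1)[OF assms] by (auto simp: act_f1_string_vec)
  show "\<rho> f2 *v (case (i, j) of (i, j) \<Rightarrow> string_vec w i j)
      = (if j < Q then case (i, j + 1) of (i, j) \<Rightarrow> string_vec w i j else 0)"
    using j string_vec_natural(2)[OF assms] by (auto simp: act_f2_string_vec)
  show "\<rho> e1 *v (case (i, j) of (i, j) \<Rightarrow> string_vec w i j)
      = (if i = 0 then 0 else of_nat (i * (P - i + 1)) *s (case (i - 1, j) of (i, j) \<Rightarrow> string_vec w i j))"
    using act_e1_string_vec[OF assms(1)] of_nat_raise_coeff[of "i - 1" P, where 'a=complex] i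
    by (cases i) (simp_all del: of_nat_Suc)
  show "\<rho> e2 *v (case (i, j) of (i, j) \<Rightarrow> string_vec w i j)
      = (if j = 0 then 0 else of_nat (j * (Q - j + 1)) *s (case (i, j - 1) of (i, j) \<Rightarrow> string_vec w i j))"
    using act_e2_string_vec[OF assms(1)] of_nat_raise_coeff[of "j - 1" Q, where 'a=complex] j
    by (cases j) (simp_all del: of_nat_Suc)
qed

lemma dim_string_block:
  assumes "s_primitive (of_nat P) (of_nat Q) w" "w \<noteq> 0"
  shows "vec.dim (string_block w P Q) = Suc P * Suc Q"
proof -
  note indep = string_block_independent[OF assms]
  have "vec.dim (string_block w P Q) = card ((\<lambda>(i, j). string_vec w i j) ` ({..P} \<times> {..Q}))"
    unfolding string_block_def
    by (rule vec.dim_span_eq_card_independent[OF independent_family_independent[OF _ indep]]) simp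
  also have "\<dots> = card ({..P} \<times> {..Q})"
    by (rule card_image[OF independent_family_inj_on[OF _ indep]]) simp
  finally show ?thesis by simp
qed

definition sl2_casimir_1 :: "complex^'n^'n" where
  "sl2_casimir_1 = smul 2 (\<rho> e1 ** \<rho> f1 + \<rho> f1 ** \<rho> e1) + \<rho> h1 ** \<rho> h1"

definition sl2_casimir_2 :: "complex^'n^'n" where
  "sl2_casimir_2 = smul 2 (\<rho> e2 ** \<rho> f2 + \<rho> f2 ** \<rho> e2) + \<rho> h2 ** \<rho> h2"

lemma sl2_casimir_1_string_vec:
  assumes "s_primitive p q w"
  shows "sl2_casimir_1 *v string_vec w i j = (p\<^sup>2 + 2 * p) *s string_vec w i j"
  using sl2_string_casimir[OF sl2_relations_1 s_primitive_other_lowering(1,2)[OF assms], of i j]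
  by (simp add: sl2_casimir_1_def string_vec_def smul_matrix_vector_mult matrix_vector_mult_add_rdistrib
      matrix_vector_mul_assoc[symmetric] vector_add_ldistrib)

lemma sl2_casimir_2_string_vec:
  assumes "s_primitive p q w"
  shows "sl2_casimir_2 *v string_vec w i j = (q\<^sup>2 + 2 * q) *s string_vec w i j"
  using sl2_string_casimir[OF sl2_relations_2 s_primitive_other_lowering(3,4)[OF assms], of j i]
  by (simp add: sl2_casimir_2_def string_vec_swap smul_matrix_vector_mult matrix_vector_mult_add_rdistrib
      matrix_vector_mul_assoc[symmetric] vector_add_ldistrib)

end

section \<open>Irreducible highest weight modules\<close>

locale sp4_highest_weight = sp4_rep \<rho> for \<rho> :: "complex^4^4 \<Rightarrow> complex^'n^'n" +
  fixes a b :: nat and v :: "complex^'n"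
  assumes b_le_a: "b \<le> a" and irreducible: "sp4_irreducible \<rho>" and v_nonzero: "v \<noteq> 0"
    and h1_v: "\<rho> h1 *v v = of_nat a *s v" and h2_v: "\<rho> h2 *v v = of_nat b *s v"
    and v_annihilated: "\<forall>X\<in>pos_root_vectors. \<rho> X *v v = 0"
begin

lemma positive_root_vectors_v:
  "\<rho> e_minus *v v = 0" "\<rho> e_plus *v v = 0" "\<rho> e1 *v v = 0" "\<rho> e2 *v v = 0"
  using v_annihilated by (simp_all add: pos_root_vectors_def e_minus_def e_plus_def e1_def e2_def)

lemma s_primitive_v: "s_primitive (of_nat a) (of_nat b) v"
  by (simp add: s_primitive_def positive_root_vectors_v h1_v h2_v)

lemma invariant_subspace_eq_UNIV:
  assumes "vec.subspace W" "invariant_under \<rho> sp4 W" "x \<in> W" "x \<noteq> 0"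
  shows "W = UNIV"
  using irreducible assms unfolding sp4_irreducible_def by blast

definition casimir_value :: complex where
  "casimir_value = (of_nat a)\<^sup>2 + (of_nat b)\<^sup>2 + 4 * of_nat a + 2 * of_nat b"

text \<open>Schur's lemma: the eigenspace of the Casimir operator containing \<open>v\<close> is a nonzero
  submodule.\<close>

lemma casimir_eq_scalar: "casimir z = casimir_value *s z"
proof -
  let ?W = "{z. casimir z = casimir_value *s z}"
  have "casimir 0 = 0"
    using casimir_scale[of 0 0] by simp
  then have "vec.subspace ?W"
    by (simp add: vec.subspace_def casimir_add casimir_scale vector_smult_assoc mult.commute)
  moreover have "invariant_under \<rho> sp4 ?W"
    by (auto simp: invariant_under_def casimir_act vec.scale)
  moreover have "v \<in> ?W"
    using casimir_s_primitive[OF s_primitive_v] by (simp add: positive_root_vectors_v casimir_value_def)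
  ultimately have "?W = UNIV"
    using v_nonzero by (rule invariant_subspace_eq_UNIV)
  then show ?thesis by auto
qed

lemma f_plus_e_plus_add_f_minus_e_minus:
  assumes "s_primitive p q w"
  shows "\<rho> f_plus *v (\<rho> e_plus *v w) + \<rho> f_minus *v (\<rho> e_minus *v w)
    = ((casimir_value - (p\<^sup>2 + q\<^sup>2 + 4 * p + 2 * q)) / 2) *s w"
    (is "?y = (?c / 2) *s w")
proof -
  have twice: "2 *s ?y = ?c *s w"
    using casimir_s_primitive[OF assms] casimir_eq_scalar[of w] by (simp add: vec_eq_iff algebra_simps)
  have "?y = (1/2 :: complex) *s (2 *s ?y)"
    by (simp add: vector_smult_assoc)
  also have "\<dots> = (?c / 2) *s w"
    by (simp only: twice vector_smult_assoc) simp
  finally show ?thesis .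
qed

definition p_wt :: "nat \<Rightarrow> nat \<Rightarrow> complex" where "p_wt r s = of_nat a - of_nat r - of_nat s"
definition q_wt :: "nat \<Rightarrow> nat \<Rightarrow> complex" where "q_wt r s = of_nat b - of_nat r + of_nat s"

lemma wt_simps:
  "p_wt r (Suc s) = p_wt r s - 1" "q_wt r (Suc s) = q_wt r s + 1"
  "p_wt (Suc r) s = p_wt r s - 1" "q_wt (Suc r) s = q_wt r s - 1"
  "p_wt 0 0 = of_nat a" "q_wt 0 0 = of_nat b"
  by (simp_all add: p_wt_def q_wt_def algebra_simps)

text \<open>\<open>prim_vec r s\<close> is the vector \<open>u(r, s)\<close>: it is obtained from
  \<open>v\<close> by \<open>s\<close> steps of \<open>prim_f_minus\<close> followed by
  \<open>r\<close> steps of \<open>prim_f_plus\<close>; by \<open>prim_vec_Suc_right\<close> the two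
  kinds of steps commute.\<close>

primrec prim_vec0 :: "nat \<Rightarrow> complex^'n" where
  "prim_vec0 0 = v"
| "prim_vec0 (Suc s) = prim_f_minus (p_wt 0 s) (prim_vec0 s)"

primrec prim_vec :: "nat \<Rightarrow> nat \<Rightarrow> complex^'n" where
  "prim_vec 0 s = prim_vec0 s"
| "prim_vec (Suc r) s = prim_f_plus (p_wt r s) (q_wt r s) (prim_vec r s)"

lemma s_primitive_prim_vec: "s_primitive (p_wt r s) (q_wt r s) (prim_vec r s)"
proof (induction r)
  case 0
  show ?case
    by (induction s) (simp_all add: s_primitive_v wt_simps s_primitive_prim_f_minus)
next
  case (Suc r)
  then show ?case by (simp add: wt_simps s_primitive_prim_f_plus)
qed

lemma prim_vec_Suc_right: "prim_vec r (Suc s) = prim_f_minus (p_wt r s) (prim_vec r s)"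
proof (induction r)
  case 0 then show ?case by simp
next
  case (Suc r)
  then have "prim_vec (Suc r) (Suc s)
      = prim_f_plus (p_wt r s - 1) (q_wt r s + 1) (prim_f_minus (p_wt r s) (prim_vec r s))"
    by (simp add: wt_simps)
  also have "\<dots> = prim_f_minus (p_wt r s - 1) (prim_f_plus (p_wt r s) (q_wt r s) (prim_vec r s))"
    by (simp add: prim_f_minus_prim_f_plus[OF s_primitive_prim_vec])
  finally show ?case by (simp add: wt_simps)
qed

definition e_plus_coeff :: "nat \<Rightarrow> complex" where
  "e_plus_coeff r = of_nat r * (of_nat b + 1 - of_nat r) * (of_nat a + 2 - of_nat r) * (of_nat a + of_nat b + 3 - of_nat r)"

lemma e_plus_prim_vec:
  "\<rho> e_plus *v prim_vec r s = (if r = 0 then 0 else e_plus_coeff r *s prim_vec (r - 1) s)"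
proof (induction r)
  case 0
  have "\<rho> e_plus *v prim_vec0 s = 0" for s
  proof (induction s)
    case (Suc s)
    have "\<rho> e_plus *v prim_vec0 (Suc s) = prim_f_minus (p_wt 0 s + 1) (\<rho> e_plus *v prim_vec0 s)"
      using e_plus_prim_f_minus[OF s_primitive_prim_vec[of 0 s]] by simp
    with Suc.IH show ?case by (simp add: prim_f_minus_zero)
  qed (simp add: positive_root_vectors_v)
  then show ?case by simp
next
  case (Suc r)
  let ?p = "p_wt r s" and ?q = "q_wt r s" and ?w = "prim_vec r s"
  have "\<rho> e_plus *v prim_vec (Suc r) s = prim_f_plus (?p + 1) (?q + 1) (\<rho> e_plus *v ?w)
      + (?p + ?q + 2) *s ((?q * (?p + 1)) *s ?w
                          - (\<rho> f_plus *v (\<rho> e_plus *v ?w) + \<rho> f_minus *v (\<rho> e_minus *v ?w)))"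
    by (simp add: e_plus_prim_f_plus[OF s_primitive_prim_vec])
  also have "prim_f_plus (?p + 1) (?q + 1) (\<rho> e_plus *v ?w) = e_plus_coeff r *s ?w"
    using Suc.IH by (cases r) (simp_all add: prim_f_plus_scale prim_f_plus_zero wt_simps e_plus_coeff_def)
  also have "\<rho> f_plus *v (\<rho> e_plus *v ?w) + \<rho> f_minus *v (\<rho> e_minus *v ?w)
      = ((casimir_value - (?p\<^sup>2 + ?q\<^sup>2 + 4 * ?p + 2 * ?q)) / 2) *s ?w"
    by (rule f_plus_e_plus_add_f_minus_e_minus[OF s_primitive_prim_vec])
  also have "e_plus_coeff r *s ?w + (?p + ?q + 2) *s ((?q * (?p + 1)) *s ?w
      - ((casimir_value - (?p\<^sup>2 + ?q\<^sup>2 + 4 * ?p + 2 * ?q)) / 2) *s ?w) = e_plus_coeff (Suc r) *s ?w"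
    by (simp add: vec_eq_iff e_plus_coeff_def casimir_value_def p_wt_def q_wt_def field_simps power2_eq_square)
  finally show ?case by simp
qed

primrec f_minus_coeff :: "nat \<Rightarrow> complex" where
  "f_minus_coeff 0 = 1"
| "f_minus_coeff (Suc s) = (of_nat a - of_nat s + 1) * f_minus_coeff s"

lemma prim_vec0_eq: "prim_vec0 s = f_minus_coeff s *s ((*v) (\<rho> f_minus) ^^ s) v"
proof (induction s)
  case (Suc s)
  have "prim_vec0 (Suc s) = (p_wt 0 s + 1) *s (\<rho> f_minus *v prim_vec0 s)"
    using e_plus_prim_vec[of 0 s] by (simp add: prim_f_minus_def)
  also have "\<dots> = f_minus_coeff (Suc s) *s ((*v) (\<rho> f_minus) ^^ Suc s) v"
    by (simp add: Suc.IH vec.scale vector_smult_assoc p_wt_def algebra_simps)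
  finally show ?case .
qed simp

lemma f_minus_string:
  "((*v) (\<rho> f_minus) ^^ Suc (a - b)) v = 0" "s \<le> a - b \<Longrightarrow> ((*v) (\<rho> f_minus) ^^ s) v \<noteq> 0"
proof -
  have "(\<rho> h1 - \<rho> h2) *v v = of_nat (a - b) *s v"
    using b_le_a by (simp add: matrix_vector_mult_diff_rdistrib h1_v h2_v of_nat_diff vector_sub_rdistrib)
  then show "((*v) (\<rho> f_minus) ^^ Suc (a - b)) v = 0" "s \<le> a - b \<Longrightarrow> ((*v) (\<rho> f_minus) ^^ s) v \<noteq> 0"
    using sl2_string_finite_nat[OF sl2_relations_minus positive_root_vectors_v(1) _ v_nonzero] by auto
qed

lemma f_minus_coeff_nonzero: "s \<le> a \<Longrightarrow> f_minus_coeff s \<noteq> 0"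
proof (induction s)
  case (Suc s)
  then have "of_nat a - of_nat s + 1 = (of_nat (a - s + 1) :: complex)"
    by (simp add: of_nat_diff)
  also have "\<dots> \<noteq> 0"
    by (simp only: of_nat_eq_0_iff)
  finally show ?case using Suc by simp
qed simp

lemma e_plus_coeff_nonzero:
  assumes "1 \<le> r" "r \<le> b"
  shows "e_plus_coeff r \<noteq> 0"
proof -
  have "(of_nat b + 1 - of_nat r :: complex) = of_nat (b + 1 - r)"
    "(of_nat a + 2 - of_nat r :: complex) = of_nat (a + 2 - r)"
    "(of_nat a + of_nat b + 3 - of_nat r :: complex) = of_nat (a + b + 3 - r)"
    using assms b_le_a by (simp_all add: of_nat_diff)
  then have "e_plus_coeff r = of_nat (r * (b + 1 - r) * (a + 2 - r) * (a + b + 3 - r))"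
    by (simp add: e_plus_coeff_def)
  moreover have "r * (b + 1 - r) * (a + 2 - r) * (a + b + 3 - r) \<noteq> 0"
    using assms b_le_a by simp
  ultimately show ?thesis by (metis of_nat_eq_0_iff)
qed

lemma prim_vec_nonzero: "r \<le> b \<Longrightarrow> s \<le> a - b \<Longrightarrow> prim_vec r s \<noteq> 0"
proof (induction r)
  case 0
  then show ?case
    using f_minus_coeff_nonzero[of s] f_minus_string(2)[of s]
    by (simp add: prim_vec0_eq vec.scale_eq_0_iff)
next
  case (Suc r)
  then show ?case
    using e_plus_prim_vec[of "Suc r" s] e_plus_coeff_nonzero[of "Suc r"] by auto
qed

lemma prim_vec_beyond_right: "prim_vec r (Suc (a - b)) = 0"
  by (induction r) (simp_all add: prim_vec0_eq f_minus_string(1) prim_f_plus_zero del: funpow.simps)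

text \<open>An \<open>s\<close>-primitive vector of weight \<open>(p, -1)\<close> must vanish, since
  \<open>sl2\<close>-weights of highest weight vectors are natural numbers.\<close>

lemma prim_vec_beyond_left: "prim_vec (Suc b) s = 0"
proof (induction s)
  case 0
  show ?case
  proof (rule ccontr)
    assume nonzero: "prim_vec (Suc b) 0 \<noteq> 0"
    have "q_wt (Suc b) 0 = -1" by (simp add: q_wt_def)
    with s_primitiveD[OF s_primitive_prim_vec] obtain m where "(-1::complex) = of_nat m"
      using sl2_string_finite[OF sl2_relations_2 _ _ nonzero] by metis
    then have "(of_nat (Suc m) :: complex) = 0" by (simp flip: \<open>-1 = of_nat m\<close>)
    then show False by (simp only: of_nat_eq_0_iff)
  qed
next
  case (Suc s)
  then show ?case by (simp add: prim_vec_Suc_right prim_f_minus_zero)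
qed

definition e_minus_coeff :: "nat \<Rightarrow> complex" where
  "e_minus_coeff s = (of_nat b + of_nat s + 2) * (of_nat a - of_nat s + 1) * (of_nat s + 1) * (of_nat a - of_nat b - of_nat s)"

lemma prim_e_minus_prim_vec_0: "prim_e_minus (q_wt r 0) (prim_vec r 0) = 0"
proof (induction r)
  case 0 then show ?case by (simp add: prim_e_minus_def positive_root_vectors_v)
next
  case (Suc r)
  then show ?case
    using prim_e_minus_prim_f_plus[OF s_primitive_prim_vec[of r 0]] by (simp add: wt_simps prim_f_plus_zero)
qed

lemma prim_e_minus_prim_vec_Suc: "prim_e_minus (q_wt r (Suc s)) (prim_vec r (Suc s)) = e_minus_coeff s *s prim_vec r s"
proof (induction r)
  case 0
  have "\<rho> e_minus *v ((*v) (\<rho> f_minus) ^^ Suc s) v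
      = (of_nat (Suc s) * ((of_nat a - of_nat b) - of_nat s)) *s ((*v) (\<rho> f_minus) ^^ s) v"
    using sl2_string_raise[OF sl2_relations_minus positive_root_vectors_v(1)] h1_v h2_v
    by (simp add: matrix_vector_mult_diff_rdistrib vector_sub_rdistrib del: funpow.simps)
  then have e_minus_vec: "\<rho> e_minus *v prim_vec0 (Suc s)
      = f_minus_coeff (Suc s) *s ((of_nat (Suc s) * ((of_nat a - of_nat b) - of_nat s)) *s ((*v) (\<rho> f_minus) ^^ s) v)"
    by (simp only: prim_vec0_eq vec.scale)
  have "prim_e_minus q (prim_vec0 (Suc s)) = (q + 1) *s (\<rho> e_minus *v prim_vec0 (Suc s))" for q
    using e_plus_prim_vec[of 0 "Suc s"] by (simp add: prim_e_minus_def del: prim_vec0.simps)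
  then have "prim_e_minus (q_wt 0 (Suc s)) (prim_vec0 (Suc s))
      = (q_wt 0 (Suc s) + 1) *s (f_minus_coeff (Suc s) *s
          ((of_nat (Suc s) * ((of_nat a - of_nat b) - of_nat s)) *s ((*v) (\<rho> f_minus) ^^ s) v))"
    by (simp only: e_minus_vec)
  moreover have "(q_wt 0 (Suc s) + 1) * (f_minus_coeff (Suc s) * (of_nat (Suc s) * ((of_nat a - of_nat b) - of_nat s)))
      = e_minus_coeff s * f_minus_coeff s"
    by (simp add: q_wt_def e_minus_coeff_def algebra_simps)
  ultimately show ?case
    by (simp only: prim_vec.simps prim_vec0_eq[of s] vector_smult_assoc)
next
  case (Suc r)
  then show ?case
    using prim_e_minus_prim_f_plus[OF s_primitive_prim_vec[of r "Suc s"]]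
    by (simp add: wt_simps prim_f_plus_scale)
qed

definition p_nat :: "nat \<Rightarrow> nat \<Rightarrow> nat" where "p_nat r s = a - r - s"
definition q_nat :: "nat \<Rightarrow> nat \<Rightarrow> nat" where "q_nat r s = b - r + s"

lemma phi_eq: "phi a b (r, s) = (p_nat r s, q_nat r s)"
  by (simp add: phi_def p_nat_def q_nat_def)

lemma Idx_iff: "(r, s) \<in> Idx a b \<longleftrightarrow> r \<le> b \<and> s \<le> a - b"
  by (simp add: Idx_def)

lemma finite_Idx: "finite (Idx a b)"
  by (rule finite_subset[of _ "{..b} \<times> {..a - b}"]) (auto simp: Idx_def)

lemma wt_eq_nat:
  assumes "(r, s) \<in> Idx a b"
  shows "p_wt r s = of_nat (p_nat r s)" "q_wt r s = of_nat (q_nat r s)"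
  using assms b_le_a by (auto simp: Idx_def p_wt_def q_wt_def p_nat_def q_nat_def of_nat_diff)

lemma s_primitive_prim_vec_nat:
  "(r, s) \<in> Idx a b \<Longrightarrow> s_primitive (of_nat (p_nat r s)) (of_nat (q_nat r s)) (prim_vec r s)"
  using s_primitive_prim_vec[of r s] by (simp add: wt_eq_nat)

lemma prim_vec_Idx_nonzero: "(r, s) \<in> Idx a b \<Longrightarrow> prim_vec r s \<noteq> 0"
  by (simp add: Idx_iff prim_vec_nonzero)

definition component :: "nat \<times> nat \<Rightarrow> (complex^'n) set" where
  "component = (\<lambda>(r, s). string_block (prim_vec r s) (p_nat r s) (q_nat r s))"

definition basis_index :: "((nat \<times> nat) \<times> (nat \<times> nat)) set" where
  "basis_index = (SIGMA (r, s):Idx a b. {..p_nat r s} \<times> {..q_nat r s})"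

definition basis_vec :: "(nat \<times> nat) \<times> (nat \<times> nat) \<Rightarrow> complex^'n" where
  "basis_vec = (\<lambda>((r, s), (i, j)). string_vec (prim_vec r s) i j)"

definition span_basis :: "(complex^'n) set" where
  "span_basis = vec.span (basis_vec ` basis_index)"

lemma finite_basis_index: "finite basis_index"
  unfolding basis_index_def using finite_Idx by auto

lemma string_vec_in_span_basis:
  "(r, s) \<in> Idx a b \<Longrightarrow> i \<le> p_nat r s \<Longrightarrow> j \<le> q_nat r s \<Longrightarrow> string_vec (prim_vec r s) i j \<in> span_basis"
  unfolding span_basis_def by (rule vec.span_base) (force simp: basis_index_def basis_vec_def)

lemma prim_vec_in_span_basis: "(r, s) \<in> Idx a b \<Longrightarrow> prim_vec r s \<in> span_basis"
  using string_vec_in_span_basis[of r s 0 0] by (simp add: string_vec_def)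

lemma component_subset_span_basis:
  assumes "(r, s) \<in> Idx a b"
  shows "component (r, s) \<subseteq> span_basis"
proof -
  have "(\<lambda>(i, j). string_vec (prim_vec r s) i j) ` ({..p_nat r s} \<times> {..q_nat r s}) \<subseteq> basis_vec ` basis_index"
    using assms by (force simp: basis_index_def basis_vec_def)
  then show ?thesis
    unfolding component_def string_block_def span_basis_def by (simp add: vec.span_mono)
qed

lemma act_s_span_basis:
  assumes "G \<in> {e1, f1, h1, e2, f2, h2}" "z \<in> span_basis"
  shows "\<rho> G *v z \<in> span_basis"
  using assms(2) unfolding span_basis_def
proof (rule matrix_vector_mult_span_closed[rotated])
  fix x assume "x \<in> basis_vec ` basis_index"
  then obtain r s i j where rs: "(r, s) \<in> Idx a b" and ij: "i \<le> p_nat r s" "j \<le> q_nat r s"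
    and x: "x = string_vec (prim_vec r s) i j"
    by (auto simp: basis_index_def basis_vec_def)
  have "\<rho> G *v x \<in> component (r, s)"
    unfolding x component_def
    using act_s_string_vec_in_block[OF s_primitive_prim_vec_nat[OF rs] prim_vec_Idx_nonzero[OF rs] assms(1) ij]
    by simp
  then show "\<rho> G *v x \<in> vec.span (basis_vec ` basis_index)"
    using component_subset_span_basis[OF rs] by (auto simp: span_basis_def)
qed

lemma subspace_span_basis: "vec.subspace span_basis"
  by (simp add: span_basis_def)

text \<open>Each of \<open>prim_e_minus\<close>, \<open>prim_f_minus\<close>, \<open>prim_f_plus\<close> maps
  \<open>prim_vec r s\<close> to a multiple of a neighbouring \<open>prim_vec\<close>, or to zero at
  the border of \<open>Idx a b\<close>.\<close>

lemma prim_e_minus_prim_vec_in_span: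
  "(r, s) \<in> Idx a b \<Longrightarrow> prim_e_minus (q_wt r s) (prim_vec r s) \<in> span_basis"
  using prim_e_minus_prim_vec_0[of r] prim_e_minus_prim_vec_Suc[of r "s - 1"]
    prim_vec_in_span_basis[of r "s - 1"] vec.subspace_0[OF subspace_span_basis]
    vec.subspace_scale[OF subspace_span_basis]
  by (cases s) (auto simp: Idx_iff)

lemma prim_f_minus_prim_vec_in_span:
  "(r, s) \<in> Idx a b \<Longrightarrow> prim_f_minus (p_wt r s) (prim_vec r s) \<in> span_basis"
  using prim_vec_in_span_basis[of r "Suc s"] prim_vec_beyond_right[of r]
    vec.subspace_0[OF subspace_span_basis]
  by (cases "s < a - b") (auto simp: Idx_iff simp flip: prim_vec_Suc_right)

lemma prim_f_plus_prim_vec_in_span: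
  "(r, s) \<in> Idx a b \<Longrightarrow> prim_f_plus (p_wt r s) (q_wt r s) (prim_vec r s) \<in> span_basis"
  using prim_vec_in_span_basis[of "Suc r" s] prim_vec_beyond_left[of s]
    vec.subspace_0[OF subspace_span_basis]
  by (cases "r < b") (auto simp: Idx_iff)

lemma short_root_vectors_prim_vec:
  assumes rs: "(r, s) \<in> Idx a b"
  shows "\<forall>X\<in>{e_minus, f_minus, e_plus, f_plus}. \<rho> X *v prim_vec r s \<in> span_basis"
proof -
  let ?w = "prim_vec r s" and ?p = "p_wt r s" and ?q = "q_wt r s"
  note S = subspace_span_basis
  have nonzero: "?p + 1 \<noteq> 0" "?q + 1 \<noteq> 0"
    unfolding wt_eq_nat[OF rs]
    using of_nat_neq_0[of "p_nat r s", where 'a=complex] of_nat_neq_0[of "q_nat r s", where 'a=complex]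
    by (simp_all add: add.commute)
  have f1: "\<rho> f1 *v z \<in> span_basis" and f2: "\<rho> f2 *v z \<in> span_basis" if "z \<in> span_basis" for z
    using act_s_span_basis that by auto
  have e_plus: "\<rho> e_plus *v ?w \<in> span_basis"
    using e_plus_prim_vec[of r s] prim_vec_in_span_basis[of "r - 1" s] rs vec.subspace_scale[OF S]
      vec.subspace_0[OF S] by (auto simp: Idx_iff)
  have "(?q + 1) *s (\<rho> e_minus *v ?w) = prim_e_minus ?q ?w - \<rho> f2 *v (\<rho> e_plus *v ?w)"
    by (simp add: prim_e_minus_def)
  then have "(?q + 1) *s (\<rho> e_minus *v ?w) \<in> span_basis"
    using vec.subspace_diff[OF S prim_e_minus_prim_vec_in_span[OF rs] f2[OF e_plus]] by simp
  then have e_minus: "\<rho> e_minus *v ?w \<in> span_basis"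
    by (rule vec_subspace_scale_cancel[OF S _ nonzero(2)])
  have "(?p + 1) *s (\<rho> f_minus *v ?w) = prim_f_minus ?p ?w - \<rho> f1 *v (\<rho> e_plus *v ?w)"
    by (simp add: prim_f_minus_def)
  then have "(?p + 1) *s (\<rho> f_minus *v ?w) \<in> span_basis"
    using vec.subspace_diff[OF S prim_f_minus_prim_vec_in_span[OF rs] f1[OF e_plus]] by simp
  then have f_minus: "\<rho> f_minus *v ?w \<in> span_basis"
    by (rule vec_subspace_scale_cancel[OF S _ nonzero(1)])
  have "((?p + 1) * (?q + 1)) *s (\<rho> f_plus *v ?w) = prim_f_plus ?p ?q ?w
      + (?q + 1) *s (\<rho> f1 *v (\<rho> e_minus *v ?w)) + (?p + 1) *s (\<rho> f2 *v (\<rho> f_minus *v ?w))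
      + \<rho> f1 *v (\<rho> f2 *v (\<rho> e_plus *v ?w))"
    by (simp add: prim_f_plus_def)
  then have "((?p + 1) * (?q + 1)) *s (\<rho> f_plus *v ?w) \<in> span_basis"
    using prim_f_plus_prim_vec_in_span[OF rs] f1[OF e_minus] f2[OF f_minus] f1[OF f2[OF e_plus]]
    by (simp add: vec.subspace_add[OF S] vec.subspace_scale[OF S])
  then have f_plus: "\<rho> f_plus *v ?w \<in> span_basis"
    by (rule vec_subspace_scale_cancel[OF S]) (use nonzero in simp)
  show ?thesis using e_minus f_minus e_plus f_plus by simp
qed

lemma short_root_vectors_f1:
  assumes "\<forall>X\<in>{e_minus, f_minus, e_plus, f_plus}. \<rho> X *v y \<in> span_basis"
  shows "\<forall>X\<in>{e_minus, f_minus, e_plus, f_plus}. \<rho> X *v (\<rho> f1 *v y) \<in> span_basis"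
  using assms act_s_span_basis[of f1]
  by (simp add: commutation_relations vec.subspace_add[OF subspace_span_basis]
      vec.subspace_diff[OF subspace_span_basis] vec.subspace_scale[OF subspace_span_basis])

lemma short_root_vectors_f2:
  assumes "\<forall>X\<in>{e_minus, f_minus, e_plus, f_plus}. \<rho> X *v y \<in> span_basis"
  shows "\<forall>X\<in>{e_minus, f_minus, e_plus, f_plus}. \<rho> X *v (\<rho> f2 *v y) \<in> span_basis"
  using assms act_s_span_basis[of f2]
  by (simp add: commutation_relations vec.subspace_add[OF subspace_span_basis]
      vec.subspace_diff[OF subspace_span_basis] vec.subspace_scale[OF subspace_span_basis])

lemma act_short_span_basis:
  assumes "X \<in> {e_minus, f_minus, e_plus, f_plus}" "z \<in> span_basis"
  shows "\<rho> X *v z \<in> span_basis"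
  using assms(2) unfolding span_basis_def
proof (rule matrix_vector_mult_span_closed[rotated])
  fix x assume "x \<in> basis_vec ` basis_index"
  then obtain r s i j where rs: "(r, s) \<in> Idx a b" and x: "x = string_vec (prim_vec r s) i j"
    by (auto simp: basis_index_def basis_vec_def)
  have "\<forall>X\<in>{e_minus, f_minus, e_plus, f_plus}. \<rho> X *v ((*v) (\<rho> f2) ^^ j) (prim_vec r s) \<in> span_basis"
    by (induction j) (simp_all add: short_root_vectors_prim_vec[OF rs] short_root_vectors_f2 del: insert_iff)
  then have "\<forall>X\<in>{e_minus, f_minus, e_plus, f_plus}. \<rho> X *v x \<in> span_basis"
    unfolding x string_vec_def by (induction i) (simp_all add: short_root_vectors_f1 del: insert_iff)
  with assms(1) show "\<rho> X *v x \<in> vec.span (basis_vec ` basis_index)"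
    by (auto simp: span_basis_def)
qed

lemma span_basis_eq_UNIV: "span_basis = UNIV"
proof (rule invariant_subspace_eq_UNIV[OF subspace_span_basis])
  show "invariant_under \<rho> sp4 span_basis"
    using act_s_span_basis act_short_span_basis by (intro invariant_under_sp4I[OF subspace_span_basis]) auto
  show "v \<in> span_basis" "v \<noteq> 0"
    using prim_vec_in_span_basis[of 0 0] v_nonzero by (simp_all add: Idx_iff)
qed

definition basis_eigenvalues :: "((complex^'n^'n) \<times> ((nat \<times> nat) \<times> nat \<times> nat \<Rightarrow> complex)) list" where
  "basis_eigenvalues = [(\<rho> h1, \<lambda>((r, s), (i, j)). of_nat (p_nat r s) - 2 * of_nat i),
    (\<rho> h2, \<lambda>((r, s), (i, j)). of_nat (q_nat r s) - 2 * of_nat j),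
    (sl2_casimir_1, \<lambda>((r, s), _). (of_nat (p_nat r s))\<^sup>2 + 2 * of_nat (p_nat r s)),
    (sl2_casimir_2, \<lambda>((r, s), _). (of_nat (q_nat r s))\<^sup>2 + 2 * of_nat (q_nat r s))]"

lemma basis_vec_eigenvector:
  assumes "(T, \<mu>) \<in> set basis_eigenvalues" "k \<in> basis_index"
  shows "T *v basis_vec k = \<mu> k *s basis_vec k"
proof -
  from assms(2) obtain r s i j where k: "k = ((r, s), (i, j))" and rs: "(r, s) \<in> Idx a b"
    by (auto simp: basis_index_def)
  note prim = s_primitive_prim_vec_nat[OF rs]
  from assms(1) show ?thesis
    by (auto simp: basis_eigenvalues_def k basis_vec_def act_h1_string_vec[OF prim]
        act_h2_string_vec[OF prim] sl2_casimir_1_string_vec[OF prim] sl2_casimir_2_string_vec[OF prim])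
qed

lemma inj_on_basis_eigenvalues: "inj_on (\<lambda>k. map (\<lambda>(T, \<mu>). \<mu> k) basis_eigenvalues) basis_index"
proof (rule inj_onI)
  fix k k' assume "k \<in> basis_index" "k' \<in> basis_index"
  then obtain r s i j r' s' i' j' where k: "k = ((r, s), (i, j))" "k' = ((r', s'), (i', j'))"
    and rs: "(r, s) \<in> Idx a b" "(r', s') \<in> Idx a b"
    by (auto simp: basis_index_def)
  assume "map (\<lambda>(T, \<mu>). \<mu> k) basis_eigenvalues = map (\<lambda>(T, \<mu>). \<mu> k') basis_eigenvalues"
  then have *: "of_nat (p_nat r s) - 2 * of_nat i = (of_nat (p_nat r' s') - 2 * of_nat i' :: complex)"
    "of_nat (q_nat r s) - 2 * of_nat j = (of_nat (q_nat r' s') - 2 * of_nat j' :: complex)"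
    "(of_nat (p_nat r s))\<^sup>2 + 2 * of_nat (p_nat r s) = ((of_nat (p_nat r' s'))\<^sup>2 + 2 * of_nat (p_nat r' s') :: complex)"
    "(of_nat (q_nat r s))\<^sup>2 + 2 * of_nat (q_nat r s) = ((of_nat (q_nat r' s'))\<^sup>2 + 2 * of_nat (q_nat r' s') :: complex)"
    by (simp_all add: basis_eigenvalues_def k)
  then have pq: "p_nat r s = p_nat r' s'" "q_nat r s = q_nat r' s'"
    by (simp_all add: of_nat_square_plus_double_inj)
  with * have "i = i'" "j = j'" by simp_all
  moreover from pq rs b_le_a have "r = r'" "s = s'"
    by (auto simp: Idx_def p_nat_def q_nat_def)
  ultimately show "k = k'" by (simp add: k)
qed

lemma basis_vec_nonzero: "k \<in> basis_index \<Longrightarrow> basis_vec k \<noteq> 0"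
  using string_vec_natural(3)[OF s_primitive_prim_vec_nat prim_vec_Idx_nonzero]
  by (auto simp: basis_index_def basis_vec_def)

lemma independent_basis: "independent_family basis_index basis_vec"
  by (rule independent_family_joint_eigenvectors[OF finite_basis_index _ inj_on_basis_eigenvalues])
    (simp_all add: basis_vec_eigenvector basis_vec_nonzero)

lemma component_is_LpLq:
  assumes "rs \<in> Idx a b"
  shows "vec.subspace (component rs)" "invariant_under \<rho> s_alg (component rs)"
    "is_LpLq \<rho> (component rs) (fst (phi a b rs)) (snd (phi a b rs))"
proof -
  obtain r s where rs: "rs = (r, s)" by fastforce
  note prim = s_primitive_prim_vec_nat prim_vec_Idx_nonzero
  show "vec.subspace (component rs)"
    by (simp add: rs component_def string_block_def)
  show "invariant_under \<rho> s_alg (component rs)"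
    using string_block_invariant[OF prim] assms by (simp add: rs component_def)
  show "is_LpLq \<rho> (component rs) (fst (phi a b rs)) (snd (phi a b rs))"
    using string_block_is_LpLq[OF prim] assms by (simp add: rs component_def phi_eq)
qed

lemma span_components: "vec.span (\<Union>rs\<in>Idx a b. component rs) = UNIV"
proof -
  have "basis_vec ` basis_index \<subseteq> (\<Union>rs\<in>Idx a b. component rs)"
    by (force simp: basis_index_def basis_vec_def component_def intro: string_vec_in_block)
  then have "span_basis \<subseteq> vec.span (\<Union>rs\<in>Idx a b. component rs)"
    unfolding span_basis_def by (rule vec.span_mono)
  then show ?thesis by (auto simp: span_basis_eq_UNIV)
qed

lemma dim_eq_sum_dim_components: "vec.dim (UNIV :: (complex^'n) set) = (\<Sum>rs\<in>Idx a b. vec.dim (component rs))"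
proof -
  have "vec.dim (UNIV :: (complex^'n) set) = card (basis_vec ` basis_index)"
    using span_basis_eq_UNIV
      vec.dim_span_eq_card_independent[OF independent_family_independent[OF finite_basis_index independent_basis]]
    by (simp add: span_basis_def)
  also have "\<dots> = card basis_index"
    by (rule card_image[OF independent_family_inj_on[OF finite_basis_index independent_basis]])
  also have "\<dots> = (\<Sum>rs\<in>Idx a b. card ((\<lambda>(r, s). {..p_nat r s} \<times> {..q_nat r s}) rs))"
    unfolding basis_index_def by (rule card_SigmaI) (auto simp: finite_Idx)
  also have "\<dots> = (\<Sum>rs\<in>Idx a b. vec.dim (component rs))"
    by (rule sum.cong)
      (auto simp: component_def dim_string_block[OF s_primitive_prim_vec_nat prim_vec_Idx_nonzero])
  finally show ?thesis .
qed

lemma basis_expansion: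
  obtains c where "y = (\<Sum>k\<in>basis_index. c k *s basis_vec k)"
proof -
  have "y \<in> vec.span (basis_vec ` basis_index)"
    using span_basis_eq_UNIV by (simp add: span_basis_def)
  then obtain c where "y = (\<Sum>x\<in>basis_vec ` basis_index. c x *s x)"
    using vec.span_finite[of "basis_vec ` basis_index"] finite_basis_index by auto
  then show thesis
    by (intro that[of "c \<circ> basis_vec"])
      (simp add: sum.reindex[OF independent_family_inj_on[OF finite_basis_index independent_basis]])
qed

text \<open>A vector killed by \<open>s\<close> is killed by both \<open>sl2\<close>-Casimirs, so in its
  expansion only basis vectors of a component \<open>L(0) \<otimes> L(0)\<close> can occur.\<close>

lemma s_annihilated_vector_imp_eq:
  assumes "y \<noteq> 0" "\<forall>X\<in>s_alg. \<rho> X *v y = 0"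
  shows "a = b"
proof -
  obtain c where y: "y = (\<Sum>k\<in>basis_index. c k *s basis_vec k)"
    by (rule basis_expansion)
  obtain k where k: "k \<in> basis_index" "c k \<noteq> 0"
    using assms(1) unfolding y by (metis (no_types, lifting) sum.neutral vector_smult_lzero)
  then obtain r s i j where kk: "k = ((r, s), (i, j))" and rs: "(r, s) \<in> Idx a b"
    by (auto simp: basis_index_def)
  let ?\<mu>1 = "\<lambda>((r, s), _). ((of_nat (p_nat r s))\<^sup>2 + 2 * of_nat (p_nat r s) :: complex)"
  let ?\<mu>2 = "\<lambda>((r, s), _). ((of_nat (q_nat r s))\<^sup>2 + 2 * of_nat (q_nat r s) :: complex)"
  have eigen: "(sl2_casimir_1, ?\<mu>1) \<in> set basis_eigenvalues" "(sl2_casimir_2, ?\<mu>2) \<in> set basis_eigenvalues"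
    by (simp_all add: basis_eigenvalues_def)
  have casimirs: "sl2_casimir_1 *v y = 0" "sl2_casimir_2 *v y = 0"
    using assms(2) by (simp_all add: s_alg_annihilates_iff sl2_casimir_1_def sl2_casimir_2_def
        smul_matrix_vector_mult matrix_vector_mult_add_rdistrib matrix_vector_mul_assoc[symmetric])
  have "c k * ?\<mu>1 k = 0" "c k * ?\<mu>2 k = 0"
    using independent_family_eigen_coefficients[OF finite_basis_index independent_basis
          basis_vec_eigenvector[OF eigen(1)] casimirs(1)[unfolded y] k(1)]
      independent_family_eigen_coefficients[OF finite_basis_index independent_basis
          basis_vec_eigenvector[OF eigen(2)] casimirs(2)[unfolded y] k(1)]
    by simp_all
  with k(2) have "(of_nat (p_nat r s))\<^sup>2 + 2 * of_nat (p_nat r s) = ((of_nat 0)\<^sup>2 + 2 * of_nat 0 :: complex)"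
    "(of_nat (q_nat r s))\<^sup>2 + 2 * of_nat (q_nat r s) = ((of_nat 0)\<^sup>2 + 2 * of_nat 0 :: complex)"
    by (simp_all add: kk)
  then have "p_nat r s = 0" "q_nat r s = 0"
    by (simp_all only: of_nat_square_plus_double_inj)
  with rs b_le_a show "a = b"
    by (simp add: Idx_def p_nat_def q_nat_def)
qed

lemma s_annihilated_vector_of_eq:
  assumes "a = b"
  shows "prim_vec b 0 \<noteq> 0" "\<forall>X\<in>s_alg. \<rho> X *v prim_vec b 0 = 0"
proof -
  have rs: "(b, 0) \<in> Idx a b" and pq: "p_nat b 0 = 0" "q_nat b 0 = 0"
    unfolding Idx_def p_nat_def q_nat_def using assms by simp_all
  note prim = s_primitive_prim_vec_nat[OF rs, unfolded pq] prim_vec_Idx_nonzero[OF rs]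
  show "prim_vec b 0 \<noteq> 0" by (rule prim(2))
  have "\<rho> f1 *v prim_vec b 0 = 0" "\<rho> f2 *v prim_vec b 0 = 0"
    using string_vec_natural(1)[OF prim, of 0] string_vec_natural(2)[OF prim, of 0]
    by (simp_all add: string_vec_def)
  with s_primitiveD[OF prim(1)] show "\<forall>X\<in>s_alg. \<rho> X *v prim_vec b 0 = 0"
    by (simp add: s_alg_annihilates_iff)
qed

end

section \<open>The main theorem\<close>

lemma inj_on_phi: "b \<le> a \<Longrightarrow> inj_on (phi a b) (Idx a b)"
  unfolding inj_on_def Idx_def phi_def by auto

lemma zero_in_Phi_iff:
  assumes "b \<le> a"
  shows "(0, 0) \<in> Phi a b \<longleftrightarrow> a = b"
proof
  assume "(0, 0) \<in> Phi a b"
  then obtain r s where "r \<le> b" "s \<le> a - b" "(0, 0) = (a - r - s, b - r + s)"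
    by (auto simp: Phi_def Idx_def phi_def)
  with assms show "a = b" by auto
next
  assume "a = b"
  then have "(0, 0) = phi a b (b, 0)" "(b, 0) \<in> Idx a b"
    by (auto simp: phi_def Idx_def)
  then show "(0, 0) \<in> Phi a b"
    by (auto simp: Phi_def)
qed

theorem mainTheorem9:
  fixes \<rho> :: "complex^4^4 \<Rightarrow> complex^'n^'n" and a b :: nat
  assumes "b \<le> a"
    and "is_sp4_rep \<rho>" and "sp4_irreducible \<rho>" and "has_highest_weight \<rho> a b"
  shows "(\<exists>W :: nat \<times> nat \<Rightarrow> (complex^'n) set.
            (\<forall>i\<in>Idx a b. vec.subspace (W i) \<and> invariant_under \<rho> s_alg (W i) \<and>
                          is_LpLq \<rho> (W i) (fst (phi a b i)) (snd (phi a b i))) \<and>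
            vec.span (\<Union>i\<in>Idx a b. W i) = UNIV \<and>
            vec.dim (UNIV :: (complex^'n) set) = (\<Sum>i\<in>Idx a b. vec.dim (W i)))
         \<and> inj_on (phi a b) (Idx a b)
         \<and> ((0, 0) \<in> Phi a b \<longleftrightarrow> a = b)
         \<and> ((\<exists>v :: complex^'n. v \<noteq> 0 \<and> (\<forall>X\<in>s_alg. \<rho> X *v v = 0)) \<longleftrightarrow> a = b)"
proof -
  obtain v where "v \<noteq> 0" "\<rho> h1 *v v = of_nat a *s v" "\<rho> h2 *v v = of_nat b *s v"
    "\<forall>X\<in>pos_root_vectors. \<rho> X *v v = 0"
    using assms(4) unfolding has_highest_weight_def by blast
  then interpret sp4_highest_weight \<rho> a b v
    using assms by unfold_locales auto
  show ?thesis
    using component_is_LpLq span_components dim_eq_sum_dim_components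
      s_annihilated_vector_imp_eq s_annihilated_vector_of_eq
      inj_on_phi[OF assms(1)] zero_in_Phi_iff[OF assms(1)]
    by blast
qed

end
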